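(* Let $f$ be a non-linear metric $f(R)$ gravity model, i.e. $f''(R)\neq 0$. No vacuum exterior metric of the form $$ds^2_+=A(t,r)\,dt^2-A^{-1}(t,r)\,dr^2-r^2d\Omega_{(2)}^2$$ can be smoothly matched, in the sense of metric $f(R)$ gravity and with the junction conditions required to hold for all $(t,r)$, to the interior of a collapsing uniform-density dust star.
   Context: Conventions: signature $(+,-,-,-)$, $c=1$, $\kappa=8\pi G>0$, Riemann tensor $R^{\rho}{}_{\sigma\mu\nu}=\partial_\nu\Gamma^\rho_{\sigma\mu}+\Gamma^\rho_{\lambda\nu}\Gamma^\lambda_{\sigma\mu}-(\mu\leftrightarrow\nu)$, $R_{\mu\nu}=R^\lambda{}_{\mu\lambda\nu}$, $R=g^{\mu\nu}R_{\mu\nu}$. $f$ is a smooth real function on an interval, $f_R=f'$. The field equations of metric $f(R)$ gravity are $$f_R(R)R_{\mu\nu}-\tfrac12 f(R)g_{\mu\nu}+(\nabla_\mu\nabla_\nu-g_{\mu\nu}\square)f_R(R)=-\kappa T_{\mu\nu}.$$ Interior (collapsing uniform-density dust star): constants $k\in\mathbb R$, $\rho_0>0$, $\chi_*>0$ with $1-k\chi_*^2>0$, and a smooth scale factor $a(\tau)>0$ on $[0,\tau_c)$ with $a(0)=1$, $\dot a(0)=0$ and $\dot a(\tau)<0$ for $0<\tau<\tau_c$ (collapse). The metric, for $0\le \chi\le\chi_*$, is $$ds_-^2=d\tau^2-a^2(\tau)\left(\frac{d\chi^2}{1-k\chi^2}+\chi^2d\Omega_{(2)}^2\right),$$ and it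 satisfies the field equations with $T_{\mu\nu}=\rho u_\mu u_\nu$, $u=\partial_\tau$, $\rho(\tau)=\rho_0/a^3(\tau)$. Its Ricci scalar is $R^-=6\left(\frac{\dot a^2+k}{a^2}+\frac{\ddot a}{a}\right)$. Exterior: a metric $ds_+^2=A(t,r)dt^2-B(t,r)dr^2-r^2d\Omega_{(2)}^2$ with smooth $A,B>0$ on an open domain $\mathcal D$ of the $(t,r)$ half-plane $r>0$, solving the field equations with $T_{\mu\nu}=0$; its Ricci scalar is $R^+$. (In the claim $B=A^{-1}$.) Subscripts $t,r$ on $A,B,R^+$ denote partial derivatives. Matching surface: the timelike hypersurface $\Sigma_*$ given by $\chi=\chi_*$ in interior coordinates and by $t=t_*(\tau)$, $r=r_*(\tau)$ (smooth, $\dot t_*>0$, curve contained in $\mathcal D$) in exterior coordinates, with intrinsic coordinates $(\tau,\theta,\varphi)$. Smooth matching: for a quantity $Q$, $[Q]$ is the difference of its values on $\Sigma_*$ computed from the exterior and from the interior. The four junction conditions along $\Sigma_*$ are $[h_{ab}]=0$ (induced metric), $[K_{ab}]=0$ (extrinsic curvature), $[R]=0$, and $[n^\mu\partial_\mu R]=0$, with $n$ the unit normal to $\Sigma_*$. Junction conditions for all $(t,r)$: put $\beta_0=\sqrt{1-k\chi_*^2}$. The first two junction conditions imply $\dot t_*=\beta_0\sqrt{B/A}$ and $\dot r_*^2=\beta_0^2-1/B$ along the surface. Besides the four conditions on $\Sigma_*$, it is required that the resulting relations hold at every point of $\mathcal D$: $\beta_0^2-1/B\ge 0$ on $\mathcal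 D$ and, with $u^t=\beta_0\sqrt{B/A}$, $u^r=-\sqrt{\beta_0^2-1/B}$ and $D=u^t\partial_t+u^r\partial_r$, (i) $D\big(\beta_0\sqrt{AB}\big)=\tfrac12\big[A_t (u^t)^2-B_t (u^r)^2\big]$; (ii) $R^+=6\left(\frac{(u^r)^2+1-\beta_0^2}{r^2}+\frac{D(u^r)}{r}\right)$ wherever $u^r\ne0$; (iii) $\frac{u^r}{A}R^+_t+\frac{u^t}{B}R^+_r=0$. *)

theory Defs
  imports "HOL-Analysis.Analysis"
begin

section \<open>Calculus on regions with boundary\<close>

text \<open>
  All derivatives are taken relative to a region, so that at boundary points (such as the initial
  time or the surface of the star) they are one-sided. On open regions they are the usual ones.
\<close>

primrec Ck_on :: "nat \<Rightarrow> 'a::real_normed_vector set \<Rightarrow> ('a \<Rightarrow> real) \<Rightarrow> bool" where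
  "Ck_on 0 S F \<longleftrightarrow> continuous_on S F"
| "Ck_on (Suc n) S F \<longleftrightarrow> F differentiable_on S \<and>
     (\<forall>v. Ck_on n S (\<lambda>x. frechet_derivative F (at x within S) v))"

definition smooth_on :: "'a::real_normed_vector set \<Rightarrow> ('a \<Rightarrow> real) \<Rightarrow> bool" where
  "smooth_on S F \<longleftrightarrow> (\<forall>n. Ck_on n S F)"

definition der :: "real set \<Rightarrow> (real \<Rightarrow> real) \<Rightarrow> real \<Rightarrow> real" where
  "der I F x = vector_derivative F (at x within I)"

definition pd :: "(real^'n) set \<Rightarrow> 'n \<Rightarrow> (real^'n \<Rightarrow> real) \<Rightarrow> real^'n \<Rightarrow> real" where
  "pd M i F x = vector_derivative (\<lambda>s. F (x + s *\<^sub>R axis i 1)) (at 0 within {s. x + s *\<^sub>R axis i 1 \<in> M})"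


section \<open>Curvature of a metric given in coordinates on a region M\<close>

type_synonym 'n metric = "real^'n \<Rightarrow> real^'n^'n"

definition ginv :: "'n::finite metric \<Rightarrow> 'n \<Rightarrow> 'n \<Rightarrow> real^'n \<Rightarrow> real" where
  "ginv g i j x = matrix_inv (g x) $ i $ j"

definition christoffel :: "(real^'n::finite) set \<Rightarrow> 'n metric \<Rightarrow> 'n \<Rightarrow> 'n \<Rightarrow> 'n \<Rightarrow> real^'n \<Rightarrow> real" where
  "christoffel M g \<rho> \<mu> \<nu> x = 1/2 * (\<Sum>\<sigma>\<in>UNIV. ginv g \<rho> \<sigma> x *
     (pd M \<mu> (\<lambda>x. g x $ \<sigma> $ \<nu>) x + pd M \<nu> (\<lambda>x. g x $ \<sigma> $ \<mu>) x - pd M \<sigma> (\<lambda>x. g x $ \<mu> $ \<nu>) x))"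

text \<open>
  \<open>riemann M g \<rho> \<sigma> \<mu> \<nu>\<close> has \<open>\<rho>\<close> as its upper index. Its sign is opposite to
  the most common convention; accordingly the field equations below have \<open>- \<kappa> T\<close> on the right.
\<close>

definition riemann ::
  "(real^'n::finite) set \<Rightarrow> 'n metric \<Rightarrow> 'n \<Rightarrow> 'n \<Rightarrow> 'n \<Rightarrow> 'n \<Rightarrow> real^'n \<Rightarrow> real" where
  "riemann M g \<rho> \<sigma> \<mu> \<nu> x =
     (pd M \<nu> (christoffel M g \<rho> \<sigma> \<mu>) x
        + (\<Sum>l\<in>UNIV. christoffel M g \<rho> l \<nu> x * christoffel M g l \<sigma> \<mu> x))
   - (pd M \<mu> (christoffel M g \<rho> \<sigma> \<nu>) x
        + (\<Sum>l\<in>UNIV. christoffel M g \<rho> l \<mu> x * christoffel M g l \<sigma> \<nu> x))"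

definition ricci :: "(real^'n::finite) set \<Rightarrow> 'n metric \<Rightarrow> 'n \<Rightarrow> 'n \<Rightarrow> real^'n \<Rightarrow> real" where
  "ricci M g \<mu> \<nu> x = (\<Sum>l\<in>UNIV. riemann M g l \<mu> l \<nu> x)"

definition ricci_scalar :: "(real^'n::finite) set \<Rightarrow> 'n metric \<Rightarrow> real^'n \<Rightarrow> real" where
  "ricci_scalar M g x = (\<Sum>\<mu>\<in>UNIV. \<Sum>\<nu>\<in>UNIV. ginv g \<mu> \<nu> x * ricci M g \<mu> \<nu> x)"

text \<open>The second covariant derivative of a scalar field, and the d'Alembertian.\<close>

definition hess ::
  "(real^'n::finite) set \<Rightarrow> 'n metric \<Rightarrow> (real^'n \<Rightarrow> real) \<Rightarrow> 'n \<Rightarrow> 'n \<Rightarrow> real^'n \<Rightarrow> real" where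
  "hess M g \<phi> \<mu> \<nu> x =
     pd M \<mu> (pd M \<nu> \<phi>) x - (\<Sum>l\<in>UNIV. christoffel M g l \<mu> \<nu> x * pd M l \<phi> x)"

definition box :: "(real^'n::finite) set \<Rightarrow> 'n metric \<Rightarrow> (real^'n \<Rightarrow> real) \<Rightarrow> real^'n \<Rightarrow> real" where
  "box M g \<phi> x = (\<Sum>\<mu>\<in>UNIV. \<Sum>\<nu>\<in>UNIV. ginv g \<mu> \<nu> x * hess M g \<phi> \<mu> \<nu> x)"


section \<open>Metric f(R) gravity\<close>

text \<open>The model is a function \<open>f\<close> on an interval \<open>I\<close>, in which the Ricci scalar has to take its values.\<close>

definition fR_field_equations ::
  "(real \<Rightarrow> real) \<Rightarrow> real set \<Rightarrow> real \<Rightarrow> (real^'n::finite) set \<Rightarrow> 'n metric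
     \<Rightarrow> ('n \<Rightarrow> 'n \<Rightarrow> real^'n \<Rightarrow> real) \<Rightarrow> bool" where
  "fR_field_equations f I \<kappa> M g T \<longleftrightarrow>
     (\<forall>x\<in>M. ricci_scalar M g x \<in> I \<and>
        (\<forall>\<mu> \<nu>. der I f (ricci_scalar M g x) * ricci M g \<mu> \<nu> x
            - 1/2 * f (ricci_scalar M g x) * (g x $ \<mu> $ \<nu>)
            + (hess M g (\<lambda>x. der I f (ricci_scalar M g x)) \<mu> \<nu> x
               - (g x $ \<mu> $ \<nu>) * box M g (\<lambda>x. der I f (ricci_scalar M g x)) x)
            = - \<kappa> * T \<mu> \<nu> x))"


section \<open>Smooth matching along a hypersurface\<close>

text \<open>
  A hypersurface is given by a parametrisation \<open>\<Phi>\<close> of it by intrinsic coordinates in \<open>S\<close>.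
  A normal field is given along the hypersurface, as a function of the intrinsic coordinates.
\<close>

definition metric_prod :: "real^'n^'n \<Rightarrow> real^'n \<Rightarrow> real^'n \<Rightarrow> real" where
  "metric_prod G v w = (\<Sum>\<mu>\<in>UNIV. \<Sum>\<nu>\<in>UNIV. G $ \<mu> $ \<nu> * v $ \<mu> * w $ \<nu>)"

definition tangent :: "(real^'m) set \<Rightarrow> (real^'m \<Rightarrow> real^'n) \<Rightarrow> 'm \<Rightarrow> real^'m \<Rightarrow> real^'n" where
  "tangent S \<Phi> a y = (\<chi> \<mu>. pd S a (\<lambda>y. \<Phi> y $ \<mu>) y)"

definition induced_metric ::
  "'n::finite metric \<Rightarrow> (real^'m) set \<Rightarrow> (real^'m \<Rightarrow> real^'n) \<Rightarrow> 'm \<Rightarrow> 'm \<Rightarrow> real^'m \<Rightarrow> real" where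
  "induced_metric g S \<Phi> a b y = metric_prod (g (\<Phi> y)) (tangent S \<Phi> a y) (tangent S \<Phi> b y)"

text \<open>In signature (+,-,-,-) the normal of a timelike hypersurface has square -1.\<close>

definition unit_normal ::
  "'n::finite metric \<Rightarrow> (real^'m) set \<Rightarrow> (real^'m \<Rightarrow> real^'n) \<Rightarrow> (real^'m \<Rightarrow> real^'n) \<Rightarrow> bool" where
  "unit_normal g S \<Phi> n \<longleftrightarrow>
     (\<forall>y\<in>S. metric_prod (g (\<Phi> y)) (n y) (n y) = -1 \<and>
        (\<forall>a. metric_prod (g (\<Phi> y)) (n y) (tangent S \<Phi> a y) = 0))"

text \<open>
  \<open>K\<^sub>a\<^sub>b = e\<^sub>a\<^sup>\<alpha> e\<^sub>b\<^sup>\<beta> \<nabla>\<^sub>\<alpha> n\<^sub>\<beta>\<close>. As \<open>n\<close> is only defined along the hypersurface,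
  \<open>e\<^sub>a\<^sup>\<alpha> \<partial>\<^sub>\<alpha> n\<^sub>\<beta>\<close> is the derivative of \<open>n\<^sub>\<beta>\<close> with respect to the \<open>a\<close>-th intrinsic coordinate.
\<close>

definition extrinsic_curvature ::
  "(real^'n::finite) set \<Rightarrow> 'n metric \<Rightarrow> (real^'m) set \<Rightarrow> (real^'m \<Rightarrow> real^'n) \<Rightarrow> (real^'m \<Rightarrow> real^'n)
     \<Rightarrow> 'm \<Rightarrow> 'm \<Rightarrow> real^'m \<Rightarrow> real" where
  "extrinsic_curvature M g S \<Phi> n a b y =
     (let nlow = (\<lambda>\<beta> y. \<Sum>\<nu>\<in>UNIV. g (\<Phi> y) $ \<beta> $ \<nu> * n y $ \<nu>) in
      \<Sum>\<beta>\<in>UNIV. tangent S \<Phi> b y $ \<beta> *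
        (pd S a (nlow \<beta>) y
         - (\<Sum>\<alpha>\<in>UNIV. \<Sum>l\<in>UNIV. tangent S \<Phi> a y $ \<alpha> * christoffel M g l \<alpha> \<beta> (\<Phi> y) * nlow l y)))"

definition normal_derivative ::
  "(real^'n::finite) set \<Rightarrow> (real^'m \<Rightarrow> real^'n) \<Rightarrow> (real^'m \<Rightarrow> real^'n) \<Rightarrow> (real^'n \<Rightarrow> real)
     \<Rightarrow> real^'m \<Rightarrow> real" where
  "normal_derivative M \<Phi> n F y = (\<Sum>\<mu>\<in>UNIV. n y $ \<mu> * pd M \<mu> F (\<Phi> y))"

text \<open>The primed data belong to the exterior side of the hypersurface.\<close>

definition junction_conditions ::
  "(real^'m) set
     \<Rightarrow> (real^'n::finite) set \<Rightarrow> 'n metric \<Rightarrow> (real^'m \<Rightarrow> real^'n) \<Rightarrow> (real^'m \<Rightarrow> real^'n)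
     \<Rightarrow> (real^'n) set \<Rightarrow> 'n metric \<Rightarrow> (real^'m \<Rightarrow> real^'n) \<Rightarrow> (real^'m \<Rightarrow> real^'n) \<Rightarrow> bool" where
  "junction_conditions S M g \<Phi> n M' g' \<Phi>' n' \<longleftrightarrow>
     (\<forall>y\<in>S.
        (\<forall>a b. induced_metric g' S \<Phi>' a b y - induced_metric g S \<Phi> a b y = 0) \<and>
        (\<forall>a b. extrinsic_curvature M' g' S \<Phi>' n' a b y - extrinsic_curvature M g S \<Phi> n a b y = 0) \<and>
        ricci_scalar M' g' (\<Phi>' y) - ricci_scalar M g (\<Phi> y) = 0 \<and>
        normal_derivative M' \<Phi>' n' (ricci_scalar M' g') y
          - normal_derivative M \<Phi> n (ricci_scalar M g) y = 0)"


section \<open>The collapsing dust star\<close>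

definition diag4 :: "real \<Rightarrow> real \<Rightarrow> real \<Rightarrow> real \<Rightarrow> real^4^4" where
  "diag4 p q r s = (\<chi> i j. if i = j then (vector [p, q, r, s] :: real^4) $ i else 0)"

text \<open>
  Interior coordinates: \<open>x $ 1 = \<tau>\<close>, \<open>x $ 2 = \<chi>\<close>, \<open>x $ 3 = \<theta>\<close>, \<open>x $ 4 = \<phi>\<close>. The
  centre \<open>\<chi> = 0\<close> and the axis \<open>sin \<theta> = 0\<close> are left out, because the coordinates degenerate there.
\<close>

definition star_region :: "real \<Rightarrow> real \<Rightarrow> (real^4) set" where
  "star_region \<chi>s \<tau>c = {x. 0 \<le> x $ 1 \<and> x $ 1 < \<tau>c \<and> 0 < x $ 2 \<and> x $ 2 \<le> \<chi>s \<and> 0 < x $ 3 \<and> x $ 3 < pi}"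

definition star_metric :: "real \<Rightarrow> (real \<Rightarrow> real) \<Rightarrow> 4 metric" where
  "star_metric k a x = diag4 1 (- (a (x $ 1))\<^sup>2 / (1 - k * (x $ 2)\<^sup>2))
     (- (a (x $ 1))\<^sup>2 * (x $ 2)\<^sup>2) (- (a (x $ 1))\<^sup>2 * (x $ 2)\<^sup>2 * (sin (x $ 3))\<^sup>2)"

text \<open>\<open>T\<^sub>\<mu>\<^sub>\<nu> = \<rho> u\<^sub>\<mu> u\<^sub>\<nu>\<close>, where \<open>u\<close> is the first coordinate vector field.\<close>

definition dust_stress :: "4 metric \<Rightarrow> (real \<Rightarrow> real) \<Rightarrow> 4 \<Rightarrow> 4 \<Rightarrow> real^4 \<Rightarrow> real" where
  "dust_stress g \<rho> \<mu> \<nu> x =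
     (let u = axis 1 1 :: real^4; ulow = (\<lambda>\<alpha>. \<Sum>\<beta>\<in>UNIV. g x $ \<alpha> $ \<beta> * u $ \<beta>)
      in \<rho> (x $ 1) * ulow \<mu> * ulow \<nu>)"

definition collapsing_dust_star ::
  "(real \<Rightarrow> real) \<Rightarrow> real set \<Rightarrow> real \<Rightarrow> real \<Rightarrow> real \<Rightarrow> real \<Rightarrow> real \<Rightarrow> (real \<Rightarrow> real) \<Rightarrow> bool" where
  "collapsing_dust_star f I \<kappa> k \<rho>0 \<chi>s \<tau>c a \<longleftrightarrow>
     0 < \<rho>0 \<and> 0 < \<chi>s \<and> 0 < 1 - k * \<chi>s\<^sup>2 \<and> 0 < \<tau>c \<and>
     smooth_on {0..<\<tau>c} a \<and> (\<forall>\<tau>\<in>{0..<\<tau>c}. 0 < a \<tau>) \<and>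
     a 0 = 1 \<and> der {0..<\<tau>c} a 0 = 0 \<and> (\<forall>\<tau>\<in>{0<..<\<tau>c}. der {0..<\<tau>c} a \<tau> < 0) \<and>
     fR_field_equations f I \<kappa> (star_region \<chi>s \<tau>c) (star_metric k a)
       (dust_stress (star_metric k a) (\<lambda>\<tau>. \<rho>0 / (a \<tau>) ^ 3))"


section \<open>The vacuum exterior\<close>

text \<open>Exterior coordinates: \<open>x $ 1 = t\<close>, \<open>x $ 2 = r\<close>, \<open>x $ 3 = \<theta>\<close>, \<open>x $ 4 = \<phi>\<close>.\<close>

definition ext_region :: "(real \<times> real) set \<Rightarrow> (real^4) set" where
  "ext_region \<D> = {x. (x $ 1, x $ 2) \<in> \<D> \<and> 0 < x $ 3 \<and> x $ 3 < pi}"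

definition ext_metric :: "(real \<Rightarrow> real \<Rightarrow> real) \<Rightarrow> (real \<Rightarrow> real \<Rightarrow> real) \<Rightarrow> 4 metric" where
  "ext_metric A B x = diag4 (A (x $ 1) (x $ 2)) (- B (x $ 1) (x $ 2))
     (- (x $ 2)\<^sup>2) (- (x $ 2)\<^sup>2 * (sin (x $ 3))\<^sup>2)"

definition vacuum_exterior ::
  "(real \<Rightarrow> real) \<Rightarrow> real set \<Rightarrow> real \<Rightarrow> (real \<times> real) set
     \<Rightarrow> (real \<Rightarrow> real \<Rightarrow> real) \<Rightarrow> (real \<Rightarrow> real \<Rightarrow> real) \<Rightarrow> bool" where
  "vacuum_exterior f I \<kappa> \<D> A B \<longleftrightarrow>
     open \<D> \<and> connected \<D> \<and> (\<forall>(t, r)\<in>\<D>. 0 < r) \<and>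
     smooth_on \<D> (\<lambda>(t, r). A t r) \<and> smooth_on \<D> (\<lambda>(t, r). B t r) \<and>
     (\<forall>(t, r)\<in>\<D>. 0 < A t r \<and> 0 < B t r) \<and>
     fR_field_equations f I \<kappa> (ext_region \<D>) (ext_metric A B) (\<lambda>\<mu> \<nu> x. 0)"


section \<open>Matching star and exterior\<close>

text \<open>Intrinsic coordinates of the surface: \<open>y $ 1 = \<tau>\<close>, \<open>y $ 2 = \<theta>\<close>, \<open>y $ 3 = \<phi>\<close>.\<close>

definition surface :: "real \<Rightarrow> (real^3) set" where
  "surface \<tau>c = {y. 0 \<le> y $ 1 \<and> y $ 1 < \<tau>c \<and> 0 < y $ 2 \<and> y $ 2 < pi}"

definition star_embedding :: "real \<Rightarrow> real^3 \<Rightarrow> real^4" where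
  "star_embedding \<chi>s y = vector [y $ 1, \<chi>s, y $ 2, y $ 3]"

definition ext_embedding :: "(real \<Rightarrow> real) \<Rightarrow> (real \<Rightarrow> real) \<Rightarrow> real^3 \<Rightarrow> real^4" where
  "ext_embedding ts rs y = vector [ts (y $ 1), rs (y $ 1), y $ 2, y $ 3]"

text \<open>
  Both normals point outwards, from the star to the exterior, that is, towards increasing \<open>\<chi>\<close>
  and \<open>r\<close>, respectively. This determines each of them uniquely.
\<close>

definition smoothly_matched ::
  "real \<Rightarrow> real \<Rightarrow> real \<Rightarrow> (real \<Rightarrow> real) \<Rightarrow> (real \<times> real) set
     \<Rightarrow> (real \<Rightarrow> real \<Rightarrow> real) \<Rightarrow> (real \<Rightarrow> real \<Rightarrow> real) \<Rightarrow> (real \<Rightarrow> real) \<Rightarrow> (real \<Rightarrow> real) \<Rightarrow> bool" where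
  "smoothly_matched k \<chi>s \<tau>c a \<D> A B ts rs \<longleftrightarrow>
     smooth_on {0..<\<tau>c} ts \<and> smooth_on {0..<\<tau>c} rs \<and>
     (\<forall>\<tau>\<in>{0..<\<tau>c}. 0 < der {0..<\<tau>c} ts \<tau> \<and> (ts \<tau>, rs \<tau>) \<in> \<D>) \<and>
     (\<exists>n n'.
        unit_normal (star_metric k a) (surface \<tau>c) (star_embedding \<chi>s) n \<and>
        (\<forall>y\<in>surface \<tau>c. 0 < n y $ 2) \<and>
        unit_normal (ext_metric A B) (surface \<tau>c) (ext_embedding ts rs) n' \<and>
        (\<forall>y\<in>surface \<tau>c. 0 < n' y $ 2) \<and>
        junction_conditions (surface \<tau>c)
          (star_region \<chi>s \<tau>c) (star_metric k a) (star_embedding \<chi>s) n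
          (ext_region \<D>) (ext_metric A B) (ext_embedding ts rs) n')"

definition \<beta>\<^sub>0 :: "real \<Rightarrow> real \<Rightarrow> real" where
  "\<beta>\<^sub>0 k \<chi>s = sqrt (1 - k * \<chi>s\<^sup>2)"

text \<open>
  The relations that the junction conditions imply along the surface, imposed on the whole domain.
  The Ricci scalar is a function on spacetime; it does not depend on \<open>\<theta>\<close> and \<open>\<phi>\<close>, so
  requiring its relations for all angles amounts to considering it as a function of \<open>t\<close> and \<open>r\<close>.
\<close>

definition junction_everywhere ::
  "real \<Rightarrow> real \<Rightarrow> (real \<times> real) set
     \<Rightarrow> (real \<Rightarrow> real \<Rightarrow> real) \<Rightarrow> (real \<Rightarrow> real \<Rightarrow> real) \<Rightarrow> bool" where
  "junction_everywhere k \<chi>s \<D> A B \<longleftrightarrow>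
     (let b = \<beta>\<^sub>0 k \<chi>s;
          ut = (\<lambda>t r. b * sqrt (B t r / A t r));
          ur = (\<lambda>t r. - sqrt (b\<^sup>2 - 1 / B t r));
          dt = (\<lambda>F t r. deriv (\<lambda>s. F s r) t);
          dr = (\<lambda>F t r. deriv (\<lambda>s. F t s) r);
          D = (\<lambda>F t r. ut t r * dt F t r + ur t r * dr F t r);
          M = ext_region \<D>;
          R = ricci_scalar M (ext_metric A B)
      in (\<forall>(t, r)\<in>\<D>.
            0 \<le> b\<^sup>2 - 1 / B t r \<and>
            D (\<lambda>t r. b * sqrt (A t r * B t r)) t r
              = 1/2 * (dt A t r * (ut t r)\<^sup>2 - dt B t r * (ur t r)\<^sup>2)) \<and>
         (\<forall>x\<in>M. let t = x $ 1; r = x $ 2 in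
            (ur t r \<noteq> 0 \<longrightarrow>
               R x = 6 * (((ur t r)\<^sup>2 + 1 - b\<^sup>2) / r\<^sup>2 + D ur t r / r)) \<and>
            ur t r / A t r * pd M 1 R x + ut t r / B t r * pd M 2 R x = 0))"

end

theory Submission
  imports Defs
begin

text \<open>
  For $B = 1/A$, relation (i) reads $A_t (2 \beta_0^2 - A) = 0$, while $A \le \beta_0^2$; hence
  $A_t = 0$. Then $R^+$ does not depend on $t$, and (iii) reduces to $R^+_r = 0$, so $R^+$ is
  constant on the connected domain. By $[R] = 0$ the Ricci scalar of the star, which depends on
  $\tau$ only, is constant in the star. There all derivatives of $f_R$ drop out of the trace of the
  field equations, $f_R R - 2 f = - \kappa \rho_0 / a^3$, so $a$ is constant: there is no collapse.
\<close>

section \<open>Smooth functions on open sets\<close>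

text \<open>The exterior curvature is never computed. Time independence of the metric passes to R^+
  because sums, products, reciprocals and partial derivatives all preserve invariance under small
  time shifts. The invariance has to be local, since \<D> need not contain the time segment between
  two of its points with equal r. Smoothness is tracked alongside, because constancy is drawn from a
  vanishing total derivative. The star needs an explicit computation instead: [R] = 0 speaks only
  about the surface, and homogeneity of the interior becomes visible in the formula for its Ricci
  scalar. Moreover the star region contains boundary points, where derivatives are one-sided.
  Constancy of R must be known throughout the star before the trace is taken, as the box term
  involves derivatives of f_R in all directions.\<close>

lemma has_derivative_within_cong:
  assumes "x \<in> S" "\<And>x. x \<in> S \<Longrightarrow> F x = G x"
  shows "(F has_derivative D) (at x within S) \<longleftrightarrow> (G has_derivative D) (at x within S)"
proof
  show "(G has_derivative D) (at x within S)" if "(F has_derivative D) (at x within S)"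
    using assms(1) _ that by (rule has_derivative_transform) (simp add: assms(2))
  show "(F has_derivative D) (at x within S)" if "(G has_derivative D) (at x within S)"
    using assms(1) _ that by (rule has_derivative_transform) (simp add: assms(2))
qed

lemma frechet_derivative_within_cong:
  assumes "x \<in> S" "\<And>x. x \<in> S \<Longrightarrow> F x = G x"
  shows "frechet_derivative F (at x within S) = frechet_derivative G (at x within S)"
  unfolding frechet_derivative_def by (simp only: has_derivative_within_cong[OF assms])

lemma Ck_on_cong:
  assumes "\<And>x. x \<in> S \<Longrightarrow> F x = G x"
  shows "Ck_on n S F \<longleftrightarrow> Ck_on n S G"
  using assms
proof (induction n arbitrary: F G)
  case 0
  then show ?case by (simp cong: continuous_on_cong)
next
  case (Suc n)
  have "F differentiable_on S \<longleftrightarrow> G differentiable_on S"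
    unfolding differentiable_on_def differentiable_def
    by (simp add: has_derivative_within_cong[OF _ Suc.prems] cong: ball_cong)
  moreover have "Ck_on n S (\<lambda>x. frechet_derivative F (at x within S) v)
      \<longleftrightarrow> Ck_on n S (\<lambda>x. frechet_derivative G (at x within S) v)" for v
    by (rule Suc.IH) (simp only: frechet_derivative_within_cong[OF _ Suc.prems])
  ultimately show ?case by simp
qed

text \<open>On an open set derivatives are unique, so any exhibited \<open>F'\<close> can stand for
  the chosen \<open>frechet_derivative\<close>. The hierarchy sees derivatives one direction at a
  time, so \<open>F' x v\<close> matters only for each fixed \<open>v\<close>.\<close>

lemma Ck_on_SucI:
  assumes "open S" "\<And>x. x \<in> S \<Longrightarrow> (F has_derivative F' x) (at x)"
    and "\<And>v. Ck_on n S (\<lambda>x. F' x v)"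
  shows "Ck_on (Suc n) S F"
proof -
  have "F differentiable_on S"
    using assms(2) by (meson differentiable_at_imp_differentiable_on differentiableI)
  moreover have "Ck_on n S (\<lambda>x. frechet_derivative F (at x within S) v)" for v
  proof -
    have "frechet_derivative F (at x within S) v = F' x v" if "x \<in> S" for x
      using frechet_derivative_at[OF assms(2)[OF that]] at_within_open[OF that assms(1)] by simp
    then show ?thesis by (rule Ck_on_cong[THEN iffD2, OF _ assms(3)])
  qed
  ultimately show ?thesis by simp
qed

lemma Ck_on_Suc_imp_has_derivative:
  assumes "open S" "Ck_on (Suc n) S F" "x \<in> S"
  shows "(F has_derivative frechet_derivative F (at x)) (at x)"
  using assms at_within_open[OF assms(3,1)]
  by (metis Ck_on.simps(2) differentiable_on_def frechet_derivative_works)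

lemma Ck_on_frechet_derivative:
  assumes "open S" "Ck_on (Suc n) S F"
  shows "Ck_on n S (\<lambda>x. frechet_derivative F (at x) v)"
proof -
  have "Ck_on n S (\<lambda>x. frechet_derivative F (at x within S) v)"
    using assms(2) by simp
  then show ?thesis
    by (rule Ck_on_cong[THEN iffD1, rotated]) (simp add: at_within_open[OF _ assms(1)])
qed

lemma Ck_on_Suc_imp_Ck_on: "Ck_on (Suc n) S F \<Longrightarrow> Ck_on n S F"
proof (induction n arbitrary: F)
  case 0
  then show ?case using differentiable_imp_continuous_on by auto
next
  case (Suc n)
  then show ?case by (metis Ck_on.simps(2))
qed

lemma Ck_on_const: "open S \<Longrightarrow> Ck_on n S (\<lambda>x. c)"
proof (induction n arbitrary: c)
  case (Suc n)
  show ?case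
    by (rule Ck_on_SucI[OF Suc.prems, where F' = "\<lambda>x v. 0"]) (use Suc in auto)
qed simp

lemma Ck_on_linear:
  assumes "open S" "bounded_linear F"
  shows "Ck_on n S F"
proof (cases n)
  case 0
  then show ?thesis using assms(2) by (simp add: linear_continuous_on)
next
  case (Suc m)
  have "Ck_on (Suc m) S F"
    by (rule Ck_on_SucI[OF assms(1) bounded_linear_imp_has_derivative[OF assms(2)]])
      (rule Ck_on_const[OF assms(1)])
  with Suc show ?thesis by simp
qed

lemma Ck_on_add:
  assumes "open S" "Ck_on n S F" "Ck_on n S G"
  shows "Ck_on n S (\<lambda>x. F x + G x)"
  using assms(2,3)
proof (induction n arbitrary: F G)
  case 0
  then show ?case by (auto intro: continuous_intros)
next
  case (Suc n)
  note D = Ck_on_Suc_imp_has_derivative[OF assms(1) Suc.prems(1)]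
    Ck_on_Suc_imp_has_derivative[OF assms(1) Suc.prems(2)]
  show ?case
    by (rule Ck_on_SucI[OF assms(1) has_derivative_add[OF D]], assumption+)
      (intro Suc.IH Ck_on_frechet_derivative Suc.prems assms(1))
qed

lemma Ck_on_mult:
  assumes "open S" "Ck_on n S F" "Ck_on n S G"
  shows "Ck_on n S (\<lambda>x. F x * G x)"
  using assms(2,3)
proof (induction n arbitrary: F G)
  case 0
  then show ?case by (auto intro: continuous_intros)
next
  case (Suc n)
  note D = Ck_on_Suc_imp_has_derivative[OF assms(1) Suc.prems(1)]
    Ck_on_Suc_imp_has_derivative[OF assms(1) Suc.prems(2)]
  show ?case
    by (rule Ck_on_SucI[OF assms(1) has_derivative_mult[OF D]], assumption+)
      (intro Ck_on_add Suc.IH Ck_on_frechet_derivative Suc.prems[THEN Ck_on_Suc_imp_Ck_on] Suc.prems assms(1))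
qed

lemma Ck_on_inverse:
  assumes "open S" "Ck_on n S F" "\<And>x. x \<in> S \<Longrightarrow> F x \<noteq> 0"
  shows "Ck_on n S (\<lambda>x. inverse (F x))"
  using assms(2)
proof (induction n)
  case 0
  then show ?case using assms(3) by (auto intro: continuous_intros)
next
  case (Suc n)
  note D = Ck_on_Suc_imp_has_derivative[OF assms(1) Suc.prems]
  \<comment> \<open>The derivative of a reciprocal contains that reciprocal again; its regularity of
    order \<open>n\<close> is the induction hypothesis.\<close>
  have I: "Ck_on n S (\<lambda>x. inverse (F x))"
    using Suc Ck_on_Suc_imp_Ck_on by blast
  have "Ck_on n S (\<lambda>x. - 1 * (inverse (F x) * frechet_derivative F (at x) v * inverse (F x)))" for v
    by (intro Ck_on_mult I Ck_on_const Ck_on_frechet_derivative Suc.prems assms(1))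
  then show ?case
    by (intro Ck_on_SucI[OF assms(1) Deriv.has_derivative_inverse[OF assms(3) D]]) simp_all
qed

text \<open>Restricting to linear \<open>L\<close> closes the induction without a general chain
  rule: the derivative of the composite in direction \<open>v\<close> is again a derivative of
  \<open>F\<close>, in the fixed direction \<open>L v\<close>, composed with
  \<open>L\<close>.\<close>

lemma Ck_on_compose_linear:
  assumes "open S" "open T" "bounded_linear L" "L ` T \<subseteq> S" "Ck_on n S F"
  shows "Ck_on n T (\<lambda>x. F (L x))"
  using assms(5)
proof (induction n arbitrary: F)
  case 0
  have "continuous_on T L" using assms(3) by (simp add: linear_continuous_on)
  with 0 show ?case
    using assms(4) continuous_on_compose2 by auto
next
  case (Suc n)
  have "((\<lambda>x. F (L x)) has_derivative (\<lambda>v. frechet_derivative F (at (L x)) (L v))) (at x)"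
    if "x \<in> T" for x
    using Ck_on_Suc_imp_has_derivative[OF assms(1) Suc.prems, of "L x"] that assms(4)
      has_derivative_compose[OF bounded_linear_imp_has_derivative[OF assms(3)]] by blast
  then show ?case
    by (rule Ck_on_SucI[OF assms(2)])
      (assumption, intro Suc.IH Ck_on_frechet_derivative Suc.prems assms(1))
qed

text \<open>The two claims are proved together because differentiation exchanges sine and
  cosine.\<close>

lemma Ck_on_sin_cos:
  assumes "open S" "bounded_linear L"
  shows "Ck_on n S (\<lambda>x. sin (L x)) \<and> Ck_on n S (\<lambda>x. cos (L x))"
proof (induction n)
  case 0
  have "continuous_on S L" using assms(2) by (simp add: linear_continuous_on)
  then show ?case by (auto intro: continuous_intros)
next
  case (Suc n)
  have "((\<lambda>x. sin (L x)) has_derivative (\<lambda>v. cos (L x) * L v)) (at x)"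
    "((\<lambda>x. cos (L x)) has_derivative (\<lambda>v. - 1 * sin (L x) * L v)) (at x)" for x
    by (auto intro!: derivative_eq_intros bounded_linear_imp_has_derivative[OF assms(2)])
  note D = this
  have "Ck_on (Suc n) S (\<lambda>x. sin (L x))"
    by (rule Ck_on_SucI[OF assms(1) D(1)]) (intro Ck_on_mult Ck_on_const assms(1) conjunct2[OF Suc])
  moreover have "Ck_on (Suc n) S (\<lambda>x. cos (L x))"
    by (rule Ck_on_SucI[OF assms(1) D(2)]) (intro Ck_on_mult Ck_on_const assms(1) conjunct1[OF Suc])
  ultimately show ?case ..
qed


section \<open>Partial derivatives and local translation invariance\<close>

lemma at_within_slice:
  fixes M :: "(real^'n) set"
  assumes "open M" "x \<in> M"
  shows "at 0 within {s. x + s *\<^sub>R axis i 1 \<in> M} = at (0::real)"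
proof -
  have "open ((\<lambda>s. x + s *\<^sub>R axis i 1) -` M)"
    by (intro open_vimage assms(1)) (intro continuous_intros)
  then show ?thesis using assms(2) by (intro at_within_open) (auto simp: vimage_def)
qed

lemma pd_open: "open M \<Longrightarrow> x \<in> M \<Longrightarrow> pd M i F x = vector_derivative (\<lambda>s. F (x + s *\<^sub>R axis i 1)) (at 0)"
  by (simp add: pd_def at_within_slice)

lemma pd_eq_frechet_derivative:
  assumes "open M" "x \<in> M" "F differentiable at x"
  shows "pd M i F x = frechet_derivative F (at x) (axis i 1)"
proof -
  have "((\<lambda>s. F (x + s *\<^sub>R axis i 1)) has_derivative
      (\<lambda>s. frechet_derivative F (at x) (s *\<^sub>R axis i 1))) (at 0)"
  proof (rule has_derivative_compose[where g = F])
    show "((\<lambda>s. x + s *\<^sub>R axis i 1) has_derivative (\<lambda>s. s *\<^sub>R axis i 1)) (at 0)"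
      by (auto intro!: derivative_eq_intros)
  qed (use assms(3) frechet_derivative_works in auto)
  moreover have "frechet_derivative F (at x) (s *\<^sub>R axis i 1) = s *\<^sub>R frechet_derivative F (at x) (axis i 1)" for s
    using assms(3) linear_frechet_derivative linear_scale by blast
  ultimately show ?thesis
    using assms by (simp add: pd_open has_vector_derivative_def vector_derivative_at)
qed

text \<open>The radius \<open>e\<close> serves all base points near \<open>x\<close>, not only
  \<open>x\<close> itself; this lets the property survive differentiation in directions other than
  \<open>j\<close>.\<close>

definition loc_invariant :: "(real^'n) set \<Rightarrow> 'n \<Rightarrow> (real^'n \<Rightarrow> real) \<Rightarrow> bool" where
  "loc_invariant M j F \<longleftrightarrow>
     (\<forall>x\<in>M. \<exists>e>0. \<forall>y s. dist y x < e \<longrightarrow> \<bar>s\<bar> < e \<longrightarrow> F (y + s *\<^sub>R axis j 1) = F y)"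

text \<open>Both properties are carried through the curvature formulas at once: invariance makes one
  partial derivative vanish, smoothness turns partial derivatives into values of a total
  derivative.\<close>

definition smooth_inv :: "(real^'n) set \<Rightarrow> 'n \<Rightarrow> (real^'n \<Rightarrow> real) \<Rightarrow> bool" where
  "smooth_inv M j F \<longleftrightarrow> smooth_on M F \<and> loc_invariant M j F"

lemma loc_invariant_binary:
  assumes "loc_invariant M j F" "loc_invariant M j G"
  shows "loc_invariant M j (\<lambda>x. h (F x) (G x))"
  unfolding loc_invariant_def
proof
  fix x assume "x \<in> M"
  then obtain d e where "d > 0" "e > 0"
    and "\<And>y s. dist y x < d \<Longrightarrow> \<bar>s\<bar> < d \<Longrightarrow> F (y + s *\<^sub>R axis j 1) = F y"
    and "\<And>y s. dist y x < e \<Longrightarrow> \<bar>s\<bar> < e \<Longrightarrow> G (y + s *\<^sub>R axis j 1) = G y"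
    using assms unfolding loc_invariant_def by metis
  then show "\<exists>e>0. \<forall>y s. dist y x < e \<longrightarrow> \<bar>s\<bar> < e \<longrightarrow>
      h (F (y + s *\<^sub>R axis j 1)) (G (y + s *\<^sub>R axis j 1)) = h (F y) (G y)"
    by (intro exI[of _ "min d e"]) auto
qed

lemma dist_shift_axis: "dist (y + s *\<^sub>R axis i 1) (x::real^'n) \<le> dist y x + \<bar>s\<bar>"
proof -
  have "dist (y + s *\<^sub>R axis i 1) y = \<bar>s\<bar>" by (simp add: dist_norm norm_axis_1)
  then show ?thesis using dist_triangle[of "y + s *\<^sub>R axis i 1" x y] by simp
qed

lemma loc_invariant_cong:
  assumes "open M" "\<And>x. x \<in> M \<Longrightarrow> F x = G x" "loc_invariant M j G"
  shows "loc_invariant M j F"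
  unfolding loc_invariant_def
proof
  fix x assume x: "x \<in> M"
  then obtain e where e: "e > 0" "\<And>y s. dist y x < e \<Longrightarrow> \<bar>s\<bar> < e \<Longrightarrow> G (y + s *\<^sub>R axis j 1) = G y"
    using assms(3) unfolding loc_invariant_def by metis
  obtain d where d: "d > 0" "\<And>y. dist y x < d \<Longrightarrow> y \<in> M"
    using assms(1) x open_dist by metis
  have "F (y + s *\<^sub>R axis j 1) = F y" if "dist y x < min e (d/2)" "\<bar>s\<bar> < min e (d/2)" for y s
  proof -
    have "dist (y + s *\<^sub>R axis j 1) x < d" "dist y x < d"
      using that dist_shift_axis[of y s j x] zero_le_dist[of y x] by auto
    then show ?thesis using e(2)[of y s] d(2) assms(2) that by auto
  qed
  then show "\<exists>e>0. \<forall>y s. dist y x < e \<longrightarrow> \<bar>s\<bar> < e \<longrightarrow> F (y + s *\<^sub>R axis j 1) = F y"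
    using d(1) e(1) by (intro exI[of _ "min e (d/2)"]) auto
qed

text \<open>Near 0 the two curves being differentiated coincide, so no differentiability is
  involved. Half of \<open>e\<close> leaves room for both the base point and the step \<sigma>; half
  of \<open>d\<close> keeps the shifted point inside \<open>M\<close>.\<close>

lemma loc_invariant_pd:
  assumes "open M" "loc_invariant M j F"
  shows "loc_invariant M j (pd M i F)"
  unfolding loc_invariant_def
proof
  fix x assume x: "x \<in> M"
  then obtain e where e: "e > 0" "\<And>y s. dist y x < e \<Longrightarrow> \<bar>s\<bar> < e \<Longrightarrow> F (y + s *\<^sub>R axis j 1) = F y"
    using assms(2) unfolding loc_invariant_def by metis
  obtain d where d: "d > 0" "\<And>y. dist y x < d \<Longrightarrow> y \<in> M"
    using assms(1) x open_dist by metis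
  have "pd M i F (y + s *\<^sub>R axis j 1) = pd M i F y"
    if "dist y x < min (e/2) (d/2)" "\<bar>s\<bar> < min (e/2) (d/2)" for y s
  proof -
    have M: "y + s *\<^sub>R axis j 1 \<in> M" "y \<in> M"
      using that dist_shift_axis[of y s j x] zero_le_dist[of y x] by (auto intro!: d(2))
    have "F (y + s *\<^sub>R axis j 1 + \<sigma> *\<^sub>R axis i 1) = F (y + \<sigma> *\<^sub>R axis i 1)" if "\<bar>\<sigma>\<bar> < e/2" for \<sigma>
      using e(2)[of "y + \<sigma> *\<^sub>R axis i 1" s] dist_shift_axis[of y \<sigma> i x] that
        \<open>dist y x < min (e/2) (d/2)\<close> \<open>\<bar>s\<bar> < min (e/2) (d/2)\<close> e(1) by (simp add: algebra_simps)
    then have "\<forall>\<^sub>F \<sigma> in nhds 0. F (y + s *\<^sub>R axis j 1 + \<sigma> *\<^sub>R axis i 1) = F (y + \<sigma> *\<^sub>R axis i 1)"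
      using e(1) unfolding eventually_nhds_metric by (intro exI[of _ "e/2"]) (auto simp: dist_real_def)
    then show ?thesis
      unfolding pd_open[OF assms(1) M(1)] pd_open[OF assms(1) M(2)]
      by (intro vector_derivative_cong_eq) auto
  qed
  then show "\<exists>e>0. \<forall>y s. dist y x < e \<longrightarrow> \<bar>s\<bar> < e \<longrightarrow> pd M i F (y + s *\<^sub>R axis j 1) = pd M i F y"
    using d(1) e(1) by (intro exI[of _ "min (e/2) (d/2)"]) auto
qed

lemma loc_invariant_imp_pd_eq_0:
  assumes "open M" "loc_invariant M j F" "x \<in> M"
  shows "pd M j F x = 0"
proof -
  obtain e where e: "e > 0" "\<And>s. \<bar>s\<bar> < e \<Longrightarrow> F (x + s *\<^sub>R axis j 1) = F x"
    using assms unfolding loc_invariant_def by (metis dist_self)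
  then have "\<forall>\<^sub>F s in nhds 0. F (x + s *\<^sub>R axis j 1) = F x"
    unfolding eventually_nhds_metric by (intro exI[of _ e]) (auto simp: dist_real_def)
  then have "vector_derivative (\<lambda>s. F (x + s *\<^sub>R axis j 1)) (at 0) = vector_derivative (\<lambda>s. F x) (at 0)"
    by (intro vector_derivative_cong_eq) auto
  then show ?thesis using assms by (simp add: pd_open)
qed

section \<open>Closure of smooth, locally invariant functions under the operations of
  curvature\<close>

lemma smooth_inv_const: "open M \<Longrightarrow> smooth_inv M j (\<lambda>x. c)"
  by (auto simp: smooth_inv_def smooth_on_def loc_invariant_def Ck_on_const intro: zero_less_one)

lemma smooth_inv_add:
  "open M \<Longrightarrow> smooth_inv M j F \<Longrightarrow> smooth_inv M j G \<Longrightarrow> smooth_inv M j (\<lambda>x. F x + G x)"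
  by (auto simp: smooth_inv_def smooth_on_def Ck_on_add loc_invariant_binary)

lemma smooth_inv_mult:
  "open M \<Longrightarrow> smooth_inv M j F \<Longrightarrow> smooth_inv M j G \<Longrightarrow> smooth_inv M j (\<lambda>x. F x * G x)"
  by (auto simp: smooth_inv_def smooth_on_def Ck_on_mult loc_invariant_binary)

lemma smooth_inv_diff:
  assumes "open M" "smooth_inv M j F" "smooth_inv M j G"
  shows "smooth_inv M j (\<lambda>x. F x - G x)"
  using smooth_inv_add[OF assms(1,2) smooth_inv_mult[OF assms(1) smooth_inv_const[OF assms(1), of j "-1"] assms(3)]]
  by simp

lemma smooth_inv_sum:
  assumes "open M" "\<And>i. i \<in> K \<Longrightarrow> smooth_inv M j (F i)"
  shows "smooth_inv M j (\<lambda>x. \<Sum>i\<in>K. F i x)"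
  using assms(2)
  by (induction K rule: infinite_finite_induct) (auto simp: smooth_inv_const smooth_inv_add assms(1))

lemma smooth_inv_inverse:
  assumes "open M" "smooth_inv M j F" "\<And>x. x \<in> M \<Longrightarrow> F x \<noteq> 0"
  shows "smooth_inv M j (\<lambda>x. inverse (F x))"
  using assms loc_invariant_binary[of M j F F "\<lambda>u v. inverse u"]
  by (auto simp: smooth_inv_def smooth_on_def Ck_on_inverse)

lemma smooth_inv_cong:
  assumes "open M" "smooth_inv M j G" "\<And>x. x \<in> M \<Longrightarrow> F x = G x"
  shows "smooth_inv M j F"
  using assms loc_invariant_cong[of M F G] Ck_on_cong[of M F G]
  by (auto simp: smooth_inv_def smooth_on_def)

lemma smooth_on_imp_differentiable:
  assumes "open M" "smooth_on M F" "x \<in> M"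
  shows "F differentiable at x"
  using Ck_on_Suc_imp_has_derivative[OF assms(1) _ assms(3)] assms(2)
  unfolding smooth_on_def differentiable_def by blast

lemma smooth_inv_pd:
  assumes "open M" "smooth_inv M j F"
  shows "smooth_inv M j (pd M i F)"
proof -
  have "Ck_on n M (pd M i F)" for n
  proof -
    have "Ck_on n M (\<lambda>x. frechet_derivative F (at x) (axis i 1))"
      using assms by (intro Ck_on_frechet_derivative) (auto simp: smooth_inv_def smooth_on_def simp del: Ck_on.simps)
    then show ?thesis
      using pd_eq_frechet_derivative[OF assms(1) _ smooth_on_imp_differentiable[OF assms(1)]] assms(2)
      by (subst Ck_on_cong) (auto simp: smooth_inv_def)
  qed
  then show ?thesis using assms loc_invariant_pd by (auto simp: smooth_inv_def smooth_on_def)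
qed

text \<open>Curvature is assembled from the components, the inverse metric and partial derivatives
  by sums and products, all of which stay in the class. The inverse is a separate hypothesis because
  \<open>matrix_inv\<close> is a choice, not an arithmetic expression.\<close>

lemma smooth_inv_ricci_scalar:
  assumes "open M" "\<And>\<mu> \<nu>. smooth_inv M j (\<lambda>x. g x $ \<mu> $ \<nu>)" "\<And>\<mu> \<nu>. smooth_inv M j (ginv g \<mu> \<nu>)"
  shows "smooth_inv M j (ricci_scalar M g)"
proof -
  have chr: "smooth_inv M j (christoffel M g \<rho> \<mu> \<nu>)" for \<rho> \<mu> \<nu>
    unfolding christoffel_def[abs_def]
    by (intro smooth_inv_mult smooth_inv_sum smooth_inv_const smooth_inv_diff smooth_inv_add
        smooth_inv_pd assms)
  show ?thesis
    unfolding ricci_scalar_def[abs_def] ricci_def riemann_def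
    by (intro smooth_inv_mult smooth_inv_sum smooth_inv_const smooth_inv_diff smooth_inv_add
        smooth_inv_pd assms chr)
qed


section \<open>Diagonal metrics\<close>

lemma vector_4 [simp]:
  "(vector [p, q, r, s] :: ('a::zero)^4) $ 1 = p"
  "(vector [p, q, r, s] :: ('a::zero)^4) $ 2 = q"
  "(vector [p, q, r, s] :: ('a::zero)^4) $ 3 = r"
  "(vector [p, q, r, s] :: ('a::zero)^4) $ 4 = s"
  unfolding vector_def by simp_all

lemma matrix_inv_unique:
  fixes A B :: "'a::semiring_1^'n^'n"
  assumes "A ** B = mat 1" "B ** A = mat 1"
  shows "matrix_inv A = B"
proof -
  have "A ** matrix_inv A = mat 1 \<and> matrix_inv A ** A = mat 1"
    unfolding matrix_inv_def by (rule someI[of _ B]) (simp add: assms)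
  then show ?thesis
    by (metis assms(2) matrix_mul_assoc matrix_mul_lid matrix_mul_rid)
qed

lemma diag4_nth: "diag4 p q r s $ i $ j = (if i = j then (vector [p, q, r, s] :: real^4) $ i else 0)"
  by (simp add: diag4_def)

lemma diag4_mult: "diag4 p q r s ** diag4 p' q' r' s' = diag4 (p * p') (q * q') (r * r') (s * s')"
  by (simp add: vec_eq_iff forall_4 matrix_matrix_mult_def diag4_def sum_4)

lemma matrix_inv_diag4:
  assumes "p \<noteq> 0" "q \<noteq> 0" "r \<noteq> 0" "s \<noteq> 0"
  shows "matrix_inv (diag4 p q r s) = diag4 (1/p) (1/q) (1/r) (1/s)"
proof (rule matrix_inv_unique)
  have "diag4 1 1 1 1 = mat 1"
    by (simp add: vec_eq_iff forall_4 mat_def diag4_def)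
  then show "diag4 p q r s ** diag4 (1/p) (1/q) (1/r) (1/s) = mat 1"
    "diag4 (1/p) (1/q) (1/r) (1/s) ** diag4 p q r s = mat 1"
    using assms by (simp_all add: diag4_mult)
qed


section \<open>The Ricci scalar of a static exterior\<close>

lemma open_ext_region:
  assumes "open \<D>"
  shows "open (ext_region \<D>)"
proof -
  have "open ((\<lambda>x::real^4. (x $ 1, x $ 2)) -` \<D>)"
    by (intro open_vimage assms) (intro continuous_intros)
  moreover have "open {x::real^4. 0 < x $ 3}" "open {x::real^4. x $ 3 < pi}"
    by (auto intro!: open_Collect_less continuous_intros)
  ultimately have "open ((\<lambda>x::real^4. (x $ 1, x $ 2)) -` \<D> \<inter> ({x. 0 < x $ 3} \<inter> {x. x $ 3 < pi}))"
    by blast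
  moreover have "(\<lambda>x::real^4. (x $ 1, x $ 2)) -` \<D> \<inter> ({x. 0 < x $ 3} \<inter> {x. x $ 3 < pi}) = ext_region \<D>"
    by (auto simp: ext_region_def)
  ultimately show ?thesis by simp
qed

lemma smooth_on_compose_ext_region:
  assumes "open \<D>" "smooth_on \<D> (\<lambda>(t, r). A t r)"
  shows "smooth_on (ext_region \<D>) (\<lambda>x. A (x $ 1) (x $ 2))"
proof -
  have L: "bounded_linear (\<lambda>x::real^4. (x $ 1, x $ 2))"
    by (intro bounded_linear_Pair bounded_linear_vec_nth)
  show ?thesis
    unfolding smooth_on_def
  proof
    fix n
    have "Ck_on n \<D> (\<lambda>(t, r). A t r)" using assms(2) by (simp add: smooth_on_def)
    then show "Ck_on n (ext_region \<D>) (\<lambda>x. A (x $ 1) (x $ 2))"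
      using Ck_on_compose_linear[OF assms(1) open_ext_region[OF assms(1)] L, of n "\<lambda>(t, r). A t r"]
      by (auto simp: ext_region_def)
  qed
qed

lemma smooth_on_has_real_derivative_fst:
  assumes "open \<D>" "smooth_on \<D> (\<lambda>(t, r). A t r)" "(t, r) \<in> \<D>"
  shows "((\<lambda>s. A s r) has_real_derivative deriv (\<lambda>s. A s r) t) (at t)"
proof -
  obtain D where D: "((\<lambda>(t, r). A t r) has_derivative D) (at (t, r))"
    using smooth_on_imp_differentiable[OF assms] unfolding differentiable_def by blast
  have "((\<lambda>s. (s, r)) has_derivative (\<lambda>h. (h, 0))) (at t)"
    by (intro has_derivative_Pair has_derivative_ident has_derivative_const)
  from has_derivative_compose[OF this D] have "(\<lambda>s. A s r) differentiable at t"
    unfolding differentiable_def by auto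
  then show ?thesis
    by (simp add: DERIV_deriv_iff_real_differentiable)
qed

text \<open>Vanishing \<open>deriv\<close> gives constancy only along time segments inside \<D>,
  hence the local form. With \<open>dist y x\<close> and |s| both below e/2, the whole segment
  starting at \<open>y\<close> stays in the ball of radius \<open>e\<close> about
  \<open>x\<close>.\<close>

lemma loc_invariant_static:
  assumes "open \<D>" "smooth_on \<D> (\<lambda>(t, r). A t r)"
    and "\<And>t r. (t, r) \<in> \<D> \<Longrightarrow> deriv (\<lambda>s. A s r) t = 0"
  shows "loc_invariant (ext_region \<D>) 1 (\<lambda>x. A (x $ 1) (x $ 2))"
  unfolding loc_invariant_def
proof
  fix x assume "x \<in> ext_region \<D>"
  then obtain e where e: "e > 0" "\<And>z. z \<in> ext_region \<D> \<or> dist z x < e \<Longrightarrow> z \<in> ext_region \<D>"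
    using open_ext_region[OF assms(1)] open_dist by metis
  have "A (y $ 1 + s) (y $ 2) = A (y $ 1) (y $ 2)" if "dist y x < e/2" "\<bar>s\<bar> < e/2" for y s
  proof -
    define K where "K = closed_segment (y $ 1) (y $ 1 + s)"
    have "((\<lambda>t. A t (y $ 2)) has_derivative (\<lambda>h. 0)) (at t within K)" if "t \<in> K" for t
    proof -
      have t: "\<bar>t - y $ 1\<bar> \<le> \<bar>s\<bar>"
        using that by (auto simp: K_def closed_segment_eq_real_ivl split: if_splits)
      have "y + (t - y $ 1) *\<^sub>R axis 1 1 \<in> ext_region \<D>"
        using dist_shift_axis[of y "t - y $ 1" 1 x] t \<open>dist y x < e/2\<close> \<open>\<bar>s\<bar> < e/2\<close>
        by (intro e(2)) linarith
      then have "(t, y $ 2) \<in> \<D>" by (simp add: ext_region_def axis_def)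
      then have "((\<lambda>t. A t (y $ 2)) has_real_derivative 0) (at t)"
        using smooth_on_has_real_derivative_fst[OF assms(1,2)] assms(3) by metis
      then show ?thesis
        by (simp add: has_field_derivative_def has_derivative_at_withinI lambda_zero)
    qed
    then show ?thesis
      by (intro has_derivative_zero_unique[of K]) (auto simp: K_def)
  qed
  then show "\<exists>e>0. \<forall>y s. dist y x < e \<longrightarrow> \<bar>s\<bar> < e \<longrightarrow>
      A ((y + s *\<^sub>R axis 1 1) $ 1) ((y + s *\<^sub>R axis 1 1) $ 2) = A (y $ 1) (y $ 2)"
    using e(1) by (intro exI[of _ "e/2"]) (simp add: axis_def)
qed

lemma smooth_inv_coordinate:
  "open M \<Longrightarrow> i \<noteq> j \<Longrightarrow> smooth_inv M j (\<lambda>x. x $ i)"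
  by (auto simp: smooth_inv_def smooth_on_def loc_invariant_def axis_def
      intro!: Ck_on_linear bounded_linear_vec_nth zero_less_one)

lemma smooth_inv_sin_coordinate:
  "open M \<Longrightarrow> i \<noteq> j \<Longrightarrow> smooth_inv M j (\<lambda>x. sin (x $ i))"
  using Ck_on_sin_cos[of M "\<lambda>x. x $ i"] bounded_linear_vec_nth
  by (auto simp: smooth_inv_def smooth_on_def loc_invariant_def axis_def intro!: zero_less_one)

lemma smooth_inv_ricci_scalar_static:
  assumes "open \<D>" "\<And>t r. (t, r) \<in> \<D> \<Longrightarrow> 0 < r \<and> 0 < A t r" "smooth_on \<D> (\<lambda>(t, r). A t r)"
    and "\<And>t r. (t, r) \<in> \<D> \<Longrightarrow> deriv (\<lambda>s. A s r) t = 0"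
  shows "smooth_inv (ext_region \<D>) 1 (ricci_scalar (ext_region \<D>) (ext_metric A (\<lambda>t r. 1 / A t r)))"
proof (rule smooth_inv_ricci_scalar)
  let ?M = "ext_region \<D>" and ?g = "ext_metric A (\<lambda>t r. 1 / A t r)"
  show M: "open ?M" by (rule open_ext_region[OF assms(1)])
  have pos: "0 < x $ 2" "0 < A (x $ 1) (x $ 2)" "0 < sin (x $ 3)" if "x \<in> ?M" for x
    using that assms(2) sin_gt_zero by (auto simp: ext_region_def)
  have A: "smooth_inv ?M 1 (\<lambda>x. A (x $ 1) (x $ 2))"
    using smooth_on_compose_ext_region loc_invariant_static assms by (auto simp: smooth_inv_def)
  have r: "smooth_inv ?M 1 (\<lambda>x. x $ 2)" and s: "smooth_inv ?M 1 (\<lambda>x. sin (x $ 3))"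
    using M by (auto intro: smooth_inv_coordinate smooth_inv_sin_coordinate)
  note intros = smooth_inv_mult smooth_inv_inverse smooth_inv_const A r s M
  \<comment> \<open>Powers and quotients are spelled as products and \<open>inverse\<close>, with
    \<open>- 1\<close> as a factor, to match the closure rules.\<close>
  have "smooth_inv ?M 1 (\<lambda>x. - 1 * inverse (A (x $ 1) (x $ 2)))"
    "smooth_inv ?M 1 (\<lambda>x. - 1 * (x $ 2 * x $ 2))"
    "smooth_inv ?M 1 (\<lambda>x. - 1 * (x $ 2 * x $ 2) * (sin (x $ 3) * sin (x $ 3)))"
    by (intro intros; use pos in force)+
  then have diag: "smooth_inv ?M 1 (\<lambda>x. ?g x $ i $ i)" for i
    using exhaust_4[of i] A
    by (auto simp: ext_metric_def diag4_nth power2_eq_square field_simps)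
  moreover have "smooth_inv ?M 1 (\<lambda>x. ?g x $ \<mu> $ \<nu>)" if "\<mu> \<noteq> \<nu>" for \<mu> \<nu>
    using that smooth_inv_const[OF M, of 1 0] by (simp add: ext_metric_def diag4_nth)
  ultimately show "smooth_inv ?M 1 (\<lambda>x. ?g x $ \<mu> $ \<nu>)" for \<mu> \<nu> by metis
  have ginv: "ginv ?g \<mu> \<nu> x = (if \<mu> = \<nu> then inverse (?g x $ \<mu> $ \<mu>) else 0)"
    and nz: "?g x $ \<mu> $ \<mu> \<noteq> 0" if "x \<in> ?M" for \<mu> \<nu> x
    using pos[OF that] exhaust_4[of \<mu>]
    by (auto simp: ginv_def ext_metric_def matrix_inv_diag4 diag4_nth inverse_eq_divide)
  show "smooth_inv ?M 1 (ginv ?g \<mu> \<nu>)" for \<mu> \<nu>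
  proof (cases "\<mu> = \<nu>")
    case True
    have "smooth_inv ?M 1 (\<lambda>x. inverse (?g x $ \<mu> $ \<mu>))"
      by (rule smooth_inv_inverse[OF M diag nz])
    then show ?thesis
      by (rule smooth_inv_cong[OF M]) (simp add: ginv True)
  next
    case False
    show ?thesis
      by (rule smooth_inv_cong[OF M smooth_inv_const[OF M, of 1 0]]) (simp add: ginv False)
  qed
qed

text \<open>The equatorial slice with azimuth 0 is an affine copy of \<D>, so connectedness of \<D>
  itself suffices. Along it the chain rule involves only the first two partial derivatives.\<close>

lemma ext_region_const:
  assumes "open \<D>" "connected \<D>" "smooth_on (ext_region \<D>) R"
    and "\<And>x. x \<in> ext_region \<D> \<Longrightarrow> pd (ext_region \<D>) 1 R x = 0 \<and> pd (ext_region \<D>) 2 R x = 0"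
  obtains c where "\<And>t r. (t, r) \<in> \<D> \<Longrightarrow> R (vector [t, r, pi/2, 0]) = c"
proof -
  let ?M = "ext_region \<D>"
  have M: "open ?M" by (rule open_ext_region[OF assms(1)])
  define L :: "real \<times> real \<Rightarrow> real^4"
    where "L z = fst z *\<^sub>R axis 1 1 + snd z *\<^sub>R axis 2 1 + axis 3 (pi/2)" for z
  have L: "L (t, r) = vector [t, r, pi/2, 0]" for t r
    by (simp add: L_def vec_eq_iff forall_4 axis_def)
  have "((\<lambda>z. R (L z)) has_derivative (\<lambda>h. 0)) (at z)" if "z \<in> \<D>" for z
  proof -
    have z: "L z \<in> ?M" using that by (cases z) (simp add: L ext_region_def)
    have d: "R differentiable at (L z)" by (rule smooth_on_imp_differentiable[OF M assms(3) z])
    let ?D = "frechet_derivative R (at (L z))"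
    have "(L has_derivative (\<lambda>h. fst h *\<^sub>R axis 1 1 + snd h *\<^sub>R axis 2 1)) (at z)"
      unfolding L_def by (auto intro!: derivative_eq_intros)
    from has_derivative_compose[OF this d[unfolded frechet_derivative_works]]
    have "((\<lambda>z. R (L z)) has_derivative (\<lambda>h. ?D (fst h *\<^sub>R axis 1 1 + snd h *\<^sub>R axis 2 1))) (at z)" .
    moreover have "?D (fst h *\<^sub>R axis 1 1 + snd h *\<^sub>R axis 2 1) = 0" for h
      using assms(4)[OF z] pd_eq_frechet_derivative[OF M z d] linear_frechet_derivative[OF d]
      by (simp add: linear_add linear_scale)
    ultimately show ?thesis by simp
  qed
  then have const: "R (L z) = R (L w)" if "z \<in> \<D>" "w \<in> \<D>" for z w
    by (rule has_derivative_zero_unique_connected[OF assms(1,2) _ that, of "\<lambda>z. R (L z)"])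
  show thesis
  \<comment> \<open>Any point of \<D> supplies the constant; for empty \<D> the value is arbitrary
    and nothing is claimed.\<close>
  proof (rule that[of "R (L (SOME z. z \<in> \<D>))"])
    fix t r assume tr: "(t, r) \<in> \<D>"
    then have "(SOME z. z \<in> \<D>) \<in> \<D>" by (rule someI)
    with tr show "R (vector [t, r, pi/2, 0]) = R (L (SOME z. z \<in> \<D>))"
      unfolding L[symmetric] by (rule const)
  qed
qed

lemma exterior_ricci_scalar_const:
  assumes "vacuum_exterior f I \<kappa> \<D> A (\<lambda>t r. 1 / A t r)"
    and "junction_everywhere k \<chi>s \<D> A (\<lambda>t r. 1 / A t r)" "0 < 1 - k * \<chi>s\<^sup>2"
  obtains c where "\<And>t r. (t, r) \<in> \<D> \<Longrightarrow>
    ricci_scalar (ext_region \<D>) (ext_metric A (\<lambda>t r. 1 / A t r)) (vector [t, r, pi/2, 0]) = c"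
proof -
  let ?M = "ext_region \<D>" and ?b = "\<beta>\<^sub>0 k \<chi>s"
  let ?R = "ricci_scalar ?M (ext_metric A (\<lambda>t r. 1 / A t r))"
  have \<D>: "open \<D>" "connected \<D>" and smooth: "smooth_on \<D> (\<lambda>(t, r). A t r)"
    and pos: "\<And>t r. (t, r) \<in> \<D> \<Longrightarrow> 0 < r \<and> 0 < A t r"
    using assms(1) unfolding vacuum_exterior_def by auto
  have b: "?b > 0" using assms(3) by (simp add: \<beta>\<^sub>0_def)
  have static: "deriv (\<lambda>s. A s r) t = 0" if tr: "(t, r) \<in> \<D>" for t r
  proof -
    have A: "0 < A t r" using pos tr by blast
    note dA = smooth_on_has_real_derivative_fst[OF \<D>(1) smooth tr]
    have j: "A t r \<le> ?b\<^sup>2"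
      "?b * sqrt (1 / A t r / A t r) * deriv (\<lambda>s. ?b * sqrt (A s r * (1 / A s r))) t
        + - sqrt (?b\<^sup>2 - A t r) * deriv (\<lambda>s. ?b * sqrt (A t s * (1 / A t s))) r
       = 1/2 * (deriv (\<lambda>s. A s r) t * (?b * sqrt (1 / A t r / A t r))\<^sup>2
          - deriv (\<lambda>s. 1 / A s r) t * (- sqrt (?b\<^sup>2 - A t r))\<^sup>2)"
      using assms(2) tr unfolding junction_everywhere_def Let_def by auto
    \<comment> \<open>That \<open>A * (1 / A)\<close> has square root 1 relies on positivity of
      \<open>A\<close>, which is known only on \<D>; equality near the point is enough for
      \<open>deriv\<close>.\<close>
    have "open ((\<lambda>s. (s, r)) -` \<D>)" "open ((\<lambda>s. (t, s)) -` \<D>)"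
      by (intro open_vimage \<D>(1) continuous_intros)+
    then have near: "\<forall>\<^sub>F s in nhds t. (s, r) \<in> \<D>" "\<forall>\<^sub>F s in nhds r. (t, s) \<in> \<D>"
      using tr by (auto simp: eventually_nhds vimage_def)
    have b1: "?b * sqrt (A s u * (1 / A s u)) = ?b" if "(s, u) \<in> \<D>" for s u
      using pos[OF that] by simp
    have "\<forall>\<^sub>F s in nhds t. ?b * sqrt (A s r * (1 / A s r)) = ?b"
      using near(1) by (rule eventually_mono) (rule b1)
    from deriv_cong_ev[OF this refl] have d0: "deriv (\<lambda>s. ?b * sqrt (A s r * (1 / A s r))) t = 0"
      by simp
    have "\<forall>\<^sub>F s in nhds r. ?b * sqrt (A t s * (1 / A t s)) = ?b"
      using near(2) by (rule eventually_mono) (rule b1)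
    from deriv_cong_ev[OF this refl] have d1: "deriv (\<lambda>s. ?b * sqrt (A t s * (1 / A t s))) r = 0"
      by simp
    have "((\<lambda>s. 1 / A s r) has_real_derivative - (deriv (\<lambda>s. A s r) t / (A t r)\<^sup>2)) (at t)"
      using A dA by (auto intro!: derivative_eq_intros simp: power2_eq_square)
    then have dB: "deriv (\<lambda>s. 1 / A s r) t = - (deriv (\<lambda>s. A s r) t / (A t r)\<^sup>2)"
      by (rule DERIV_imp_deriv)
    have ut: "(?b * sqrt (1 / A t r / A t r))\<^sup>2 = ?b\<^sup>2 / (A t r)\<^sup>2"
      using A by (simp add: power_mult_distrib power_divide real_sqrt_divide)
    have ur: "(- sqrt (?b\<^sup>2 - A t r))\<^sup>2 = ?b\<^sup>2 - A t r"
      using j(1) by simp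
    let ?d = "deriv (\<lambda>s. A s r) t"
    \<comment> \<open>Relation (i) multiplied by \<open>2 * (A t r)\<^sup>2\<close>; its left side
      vanishes because the product of \<open>A\<close> and \<open>B\<close> is constant on
      \<D>.\<close>
    have "?d * (2 * ?b\<^sup>2 - A t r)
        = 2 * (A t r)\<^sup>2 * (1/2 * (?d * (?b\<^sup>2 / (A t r)\<^sup>2) - - (?d / (A t r)\<^sup>2) * (?b\<^sup>2 - A t r)))"
      using A by (simp add: field_simps)
    also have "\<dots> = 2 * (A t r)\<^sup>2 * 0"
      using j(2) unfolding d0 d1 dB ut ur by (simp only: mult_zero_right add_0)
    finally have "?d * (2 * ?b\<^sup>2 - A t r) = 0" by simp
    \<comment> \<open>The bound \<open>A t r \<le> ?b\<^sup>2\<close> leaves at least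
      \<open>?b\<^sup>2\<close>, which is positive.\<close>
    moreover have "2 * ?b\<^sup>2 - A t r > 0"
      using j(1) b by (smt (verit) zero_less_power)
    ultimately show ?thesis by simp
  qed
  have R: "smooth_inv ?M 1 ?R"
    using smooth_inv_ricci_scalar_static[OF \<D>(1) pos smooth static] .
  have "pd ?M 1 ?R x = 0 \<and> pd ?M 2 ?R x = 0" if x: "x \<in> ?M" for x
  proof -
    have 1: "pd ?M 1 ?R x = 0"
      using R x by (auto simp: smooth_inv_def intro: loc_invariant_imp_pd_eq_0 open_ext_region \<D>)
    have A: "A (x $ 1) (x $ 2) > 0" using x pos by (auto simp: ext_region_def)
    \<comment> \<open>The coefficient of the radial derivative in (iii) is u^t / B = (b / A) A = b,
      which is positive; the other term is killed by time invariance.\<close>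
    have "- sqrt (?b\<^sup>2 - A (x $ 1) (x $ 2)) / A (x $ 1) (x $ 2) * pd ?M 1 ?R x
        + ?b * sqrt (1 / A (x $ 1) (x $ 2) / A (x $ 1) (x $ 2)) * A (x $ 1) (x $ 2) * pd ?M 2 ?R x = 0"
      using assms(2) x unfolding junction_everywhere_def Let_def by simp
    then show ?thesis using 1 A b by simp
  qed
  then show thesis
    using ext_region_const[OF \<D>, of ?R] R that by (auto simp: smooth_inv_def)
qed


section \<open>The Ricci scalar of the star\<close>

text \<open>Agreement on \<open>M\<close> suffices because \<open>pd\<close> differentiates relative
  to \<open>M\<close>. The explicit Christoffel symbols of the star, boundary included, are
  established only there.\<close>

lemma pd_cong:
  assumes "x \<in> M" "\<And>x. x \<in> M \<Longrightarrow> F x = G x"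
  shows "pd M i F x = pd M i G x"
proof -
  let ?S = "{s. x + s *\<^sub>R axis i 1 \<in> M}"
  have "((\<lambda>s. F (x + s *\<^sub>R axis i 1)) has_vector_derivative d) (at 0 within ?S)
      \<longleftrightarrow> ((\<lambda>s. G (x + s *\<^sub>R axis i 1)) has_vector_derivative d) (at 0 within ?S)" for d
    unfolding has_vector_derivative_def
    by (rule has_derivative_within_cong) (use assms in auto)
  then show ?thesis by (simp add: pd_def vector_derivative_def)
qed

lemma pd_const:
  assumes "at 0 within {s. x + s *\<^sub>R axis i 1 \<in> M} \<noteq> bot" "\<And>s. F (x + s *\<^sub>R axis i 1) = c"
  shows "pd M i F x = 0"
  unfolding pd_def assms(2) by (rule vector_derivative_within[OF assms(1)]) (rule has_vector_derivative_const)

text \<open>\<open>T\<close> is the range of the \<open>i\<close>-th coordinate along the slice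
  through \<open>x\<close>. A partial derivative thereby becomes a one-variable derivative relative
  to \<open>T\<close>, one-sided at an endpoint belonging to \<open>T\<close>.\<close>

lemma pd_eqI:
  assumes "{s. x + s *\<^sub>R axis i 1 \<in> M} = {s. x $ i + s \<in> T}"
    and "at 0 within {s. x + s *\<^sub>R axis i 1 \<in> M} \<noteq> bot"
    and "(h has_real_derivative d) (at (x $ i) within T)"
    and "\<And>s. F (x + s *\<^sub>R axis i 1) = h (x $ i + s)"
  shows "pd M i F x = d"
proof -
  have "(+) (x $ i) ` {s. x $ i + s \<in> T} = T"
    by (auto simp: image_iff intro!: exI[of _ "_ - x $ i"])
  then have "((\<lambda>s. h (x $ i + s)) has_real_derivative d) (at 0 within {s. x $ i + s \<in> T})"
    using assms(3) DERIV_at_within_shift[of h d "x $ i" 0 "{s. x $ i + s \<in> T}"] by simp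
  then show ?thesis
    unfolding pd_def using assms(1,2,4)
    by (simp add: vector_derivative_within has_real_derivative_iff_has_vector_derivative)
qed

text \<open>\<open>a1\<close> and \<open>a2\<close> are derivatives relative to the half-open time
  interval, hence one-sided at time 0; the Ricci tensor of the star involves no higher ones.\<close>

locale dust_star =
  fixes k \<chi>s \<tau>c :: real and a a1 a2 :: "real \<Rightarrow> real"
  assumes \<chi>s_pos: "0 < \<chi>s" and \<tau>c_pos: "0 < \<tau>c" and k_\<chi>s: "0 < 1 - k * \<chi>s\<^sup>2"
    and a_pos: "\<tau> \<in> {0..<\<tau>c} \<Longrightarrow> 0 < a \<tau>"
    and a_deriv: "\<tau> \<in> {0..<\<tau>c} \<Longrightarrow> (a has_real_derivative a1 \<tau>) (at \<tau> within {0..<\<tau>c})"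
    and a1_deriv: "\<tau> \<in> {0..<\<tau>c} \<Longrightarrow> (a1 has_real_derivative a2 \<tau>) (at \<tau> within {0..<\<tau>c})"
begin

abbreviation M where "M \<equiv> star_region \<chi>s \<tau>c"
abbreviation g where "g \<equiv> star_metric k a"

lemma slice:
  assumes "x \<in> M"
  shows "{s. x + s *\<^sub>R axis 1 1 \<in> M} = {s. x $ 1 + s \<in> {0..<\<tau>c}}"
    and "{s. x + s *\<^sub>R axis 2 1 \<in> M} = {s. x $ 2 + s \<in> {0<..\<chi>s}}"
    and "{s. x + s *\<^sub>R axis 3 1 \<in> M} = {s. x $ 3 + s \<in> {0<..<pi}}"
    and "{s. x + s *\<^sub>R axis 4 1 \<in> M} = UNIV"
  using assms by (auto simp: star_region_def axis_def)

text \<open>A relative derivative is determined only where 0 is a limit point of the slice. A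
  connected set with a second point has no isolated points; the second points lie at a later time, a
  smaller radius or a smaller polar angle, so they exist on the boundary too.\<close>

lemma slice_nontrivial:
  assumes x: "x \<in> M"
  shows "at 0 within {s. x + s *\<^sub>R axis i 1 \<in> M} \<noteq> bot"
proof -
  have limpt: "at 0 within T \<noteq> bot" if "connected T" "0 \<in> T" "s \<in> T" "s \<noteq> 0" for T and s :: real
  proof -
    have "T \<noteq> {y}" for y using that by blast
    then have "0 islimpt T" by (rule connected_imp_perfect[OF that(1,2)])
    then show ?thesis by (simp add: trivial_limit_within)
  qed
  have bounds: "0 \<le> x $ 1" "x $ 1 < \<tau>c" "0 < x $ 2" "x $ 2 \<le> \<chi>s" "0 < x $ 3" "x $ 3 < pi"
    using x by (auto simp: star_region_def)
  have "{s. x + s *\<^sub>R axis 1 1 \<in> M} = {- x $ 1..<\<tau>c - x $ 1}"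
    unfolding slice[OF x] by auto
  then have 1: "at 0 within {s. x + s *\<^sub>R axis 1 1 \<in> M} \<noteq> bot"
    using bounds by (intro limpt[where s = "(\<tau>c - x $ 1) / 2"]) (auto simp: field_simps)
  have "{s. x + s *\<^sub>R axis 2 1 \<in> M} = {- x $ 2<..\<chi>s - x $ 2}"
    unfolding slice[OF x] by auto
  then have 2: "at 0 within {s. x + s *\<^sub>R axis 2 1 \<in> M} \<noteq> bot"
    using bounds by (intro limpt[where s = "- x $ 2 / 2"]) auto
  have "{s. x + s *\<^sub>R axis 3 1 \<in> M} = {- x $ 3<..<pi - x $ 3}"
    unfolding slice[OF x] by auto
  then have 3: "at 0 within {s. x + s *\<^sub>R axis 3 1 \<in> M} \<noteq> bot"
    using bounds by (intro limpt[where s = "- x $ 3 / 2"]) auto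
  have 4: "at 0 within {s. x + s *\<^sub>R axis 4 1 \<in> M} \<noteq> bot"
    unfolding slice[OF x] by simp
  show ?thesis using exhaust_4[of i] 1 2 3 4 by (elim disjE) simp_all
qed

text \<open>The scale factor is differentiable only relative to its interval, so \<open>pd_1\<close>
  keeps the relative derivative. In radius and polar angle the functions are elementary, and an
  ordinary derivative is restricted.\<close>

lemmas pd_1 = pd_eqI[OF slice(1) slice_nontrivial]
  and pd_2 = pd_eqI[OF slice(2) slice_nontrivial has_field_derivative_at_within]
  and pd_3 = pd_eqI[OF slice(3) slice_nontrivial has_field_derivative_at_within]

lemma region_pos:
  assumes "x \<in> M"
  shows "0 < a (x $ 1)" "0 < x $ 2" "0 < 1 - k * (x $ 2)\<^sup>2" "0 < sin (x $ 3)" "x $ 1 \<in> {0..<\<tau>c}"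
proof -
  show "0 < a (x $ 1)" "0 < x $ 2" "0 < sin (x $ 3)" "x $ 1 \<in> {0..<\<tau>c}"
    using assms a_pos sin_gt_zero by (auto simp: star_region_def)
  have "(x $ 2)\<^sup>2 \<le> \<chi>s\<^sup>2"
    using assms by (auto simp: star_region_def intro: power_mono)
  \<comment> \<open>For \<open>k \<ge> 0\<close> the factor is smallest at the surface, where it is
    positive by assumption; for \<open>k < 0\<close> it is at least 1.\<close>
  then show "0 < 1 - k * (x $ 2)\<^sup>2"
  proof (cases "0 \<le> k")
    case True
    then have "k * (x $ 2)\<^sup>2 \<le> k * \<chi>s\<^sup>2" using \<open>(x $ 2)\<^sup>2 \<le> \<chi>s\<^sup>2\<close> by (rule mult_left_mono[rotated])
    then show ?thesis using k_\<chi>s by simp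
  next
    case False
    then have "k * (x $ 2)\<^sup>2 \<le> 0" by (simp add: mult_le_0_iff)
    then show ?thesis by simp
  qed
qed

section \<open>Christoffel symbols and Ricci tensor of the star\<close>

lemma ginv_star:
  assumes "x \<in> M"
  shows "ginv g i j x = diag4 1 (- ((1 - k * (x $ 2)\<^sup>2) / (a (x $ 1))\<^sup>2)) (- 1 / ((a (x $ 1))\<^sup>2 * (x $ 2)\<^sup>2))
     (- 1 / ((a (x $ 1))\<^sup>2 * (x $ 2)\<^sup>2 * (sin (x $ 3))\<^sup>2)) $ i $ j"
  using region_pos[OF assms] unfolding ginv_def star_metric_def
  by (subst matrix_inv_diag4) (auto simp: divide_simps)

lemma pd_star_metric:
  assumes x: "x \<in> M"
  defines "A \<equiv> a (x $ 1)" and "A' \<equiv> a1 (x $ 1)" and "r \<equiv> x $ 2" and "w \<equiv> 1 - k * (x $ 2)\<^sup>2"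
    and "\<theta> \<equiv> x $ 3"
  shows "pd M 1 (\<lambda>x. g x $ i $ j) x =
      diag4 0 (- 2 * A * A' / w) (- 2 * A * A' * r\<^sup>2) (- 2 * A * A' * r\<^sup>2 * (sin \<theta>)\<^sup>2) $ i $ j" (is ?d1)
    and "pd M 2 (\<lambda>x. g x $ i $ j) x =
      diag4 0 (- 2 * A\<^sup>2 * k * r / w\<^sup>2) (- 2 * A\<^sup>2 * r) (- 2 * A\<^sup>2 * r * (sin \<theta>)\<^sup>2) $ i $ j" (is ?d2)
    and "pd M 3 (\<lambda>x. g x $ i $ j) x = diag4 0 0 0 (- 2 * A\<^sup>2 * r\<^sup>2 * sin \<theta> * cos \<theta>) $ i $ j" (is ?d3)
    and "pd M 4 (\<lambda>x. g x $ i $ j) x = 0" (is ?d4)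
proof -
  note [simp] = star_metric_def diag4_nth axis_def
  note defs = A_def A'_def r_def w_def \<theta>_def
  have w: "w \<noteq> 0" using region_pos[OF x] by (simp add: w_def)
  note a' = a_deriv[OF region_pos(5)[OF x]]
  have off: "pd M l (\<lambda>x. g x $ i $ j) x = 0" if "i \<noteq> j" for l
    by (rule pd_const[OF slice_nontrivial[OF x], where c = 0]) (use that in simp)
  have g11: "pd M l (\<lambda>x. g x $ 1 $ 1) x = 0" for l
    by (rule pd_const[OF slice_nontrivial[OF x], where c = 1]) simp
  have "pd M 1 (\<lambda>x. g x $ 2 $ 2) x = - 2 * A * A' / w"
    by (rule pd_1[OF x x, where h = "\<lambda>u. - (a u)\<^sup>2 / w"])
      (use w in \<open>auto intro!: derivative_eq_intros a' simp: defs\<close>)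
  moreover have "pd M 1 (\<lambda>x. g x $ 3 $ 3) x = - 2 * A * A' * r\<^sup>2"
    by (rule pd_1[OF x x, where h = "\<lambda>u. - (a u)\<^sup>2 * r\<^sup>2"])
      (auto intro!: derivative_eq_intros a' simp: defs)
  moreover have "pd M 1 (\<lambda>x. g x $ 4 $ 4) x = - 2 * A * A' * r\<^sup>2 * (sin \<theta>)\<^sup>2"
    by (rule pd_1[OF x x, where h = "\<lambda>u. - (a u)\<^sup>2 * r\<^sup>2 * (sin \<theta>)\<^sup>2"])
      (auto intro!: derivative_eq_intros a' simp: defs)
  ultimately show ?d1 using off g11 exhaust_4[of i] by auto
  have "pd M 2 (\<lambda>x. g x $ 2 $ 2) x = - 2 * A\<^sup>2 * k * r / w\<^sup>2"
    by (rule pd_2[OF x x, where h = "\<lambda>u. - A\<^sup>2 / (1 - k * u\<^sup>2)"])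
      (use w in \<open>auto intro!: derivative_eq_intros simp: defs power2_eq_square\<close>)
  moreover have "pd M 2 (\<lambda>x. g x $ 3 $ 3) x = - 2 * A\<^sup>2 * r"
    by (rule pd_2[OF x x, where h = "\<lambda>u. - A\<^sup>2 * u\<^sup>2"])
      (auto intro!: derivative_eq_intros simp: defs)
  moreover have "pd M 2 (\<lambda>x. g x $ 4 $ 4) x = - 2 * A\<^sup>2 * r * (sin \<theta>)\<^sup>2"
    by (rule pd_2[OF x x, where h = "\<lambda>u. - A\<^sup>2 * u\<^sup>2 * (sin \<theta>)\<^sup>2"])
      (auto intro!: derivative_eq_intros simp: defs)
  ultimately show ?d2 using off g11 exhaust_4[of i] by auto
  have "pd M 3 (\<lambda>x. g x $ 2 $ 2) x = 0"
    by (rule pd_const[OF slice_nontrivial[OF x], where c = "- A\<^sup>2 / w"]) (simp add: defs)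
  moreover have "pd M 3 (\<lambda>x. g x $ 3 $ 3) x = 0"
    by (rule pd_const[OF slice_nontrivial[OF x], where c = "- A\<^sup>2 * r\<^sup>2"]) (simp add: defs)
  moreover have "pd M 3 (\<lambda>x. g x $ 4 $ 4) x = - 2 * A\<^sup>2 * r\<^sup>2 * sin \<theta> * cos \<theta>"
    by (rule pd_3[OF x x, where h = "\<lambda>u. - A\<^sup>2 * r\<^sup>2 * (sin u)\<^sup>2"])
      (auto intro!: derivative_eq_intros simp: defs)
  ultimately show ?d3 using off g11 exhaust_4[of i] by auto
  have "pd M 4 (\<lambda>x. g x $ i $ j) x = 0"
    by (rule pd_const[OF slice_nontrivial[OF x], where c = "g x $ i $ j"]) simp
  then show ?d4 .
qed

text \<open>The Friedmann-Robertson-Walker Christoffel symbols as a table: upper index outermost,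
  then the two lower ones, with \<open>H\<close> the expansion rate. As nested vectors, all 64
  entries can be evaluated by simplification.\<close>

definition star_christoffel :: "real^4 \<Rightarrow> real^4^4^4" where
  "star_christoffel x =
    (let A = a (x $ 1); A' = a1 (x $ 1); H = A' / A; r = x $ 2; w = 1 - k * r\<^sup>2; s = sin (x $ 3); c = cos (x $ 3)
     in vector
      [diag4 0 (A * A' / w) (A * A' * r\<^sup>2) (A * A' * r\<^sup>2 * s\<^sup>2),
       vector [vector [0, H, 0, 0], vector [H, k * r / w, 0, 0], vector [0, 0, - (r * w), 0], vector [0, 0, 0, - (r * w * s\<^sup>2)]],
       vector [vector [0, 0, H, 0], vector [0, 0, 1 / r, 0], vector [H, 1 / r, 0, 0], vector [0, 0, 0, - (s * c)]],
       vector [vector [0, 0, 0, H], vector [0, 0, 0, 1 / r], vector [0, 0, 0, c / s], vector [H, 1 / r, c / s, 0]]])"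

lemma christoffel_star:
  assumes x: "x \<in> M"
  shows "christoffel M g \<rho> \<mu> \<nu> x = star_christoffel x $ \<rho> $ \<mu> $ \<nu>"
proof -
  \<comment> \<open>As an atom, \<open>w\<close> is not expanded when denominators are
    cleared.\<close>
  define w where "w = 1 - k * (x $ 2)\<^sup>2"
  have "\<forall>\<rho> \<mu> \<nu>. christoffel M g \<rho> \<mu> \<nu> x = star_christoffel x $ \<rho> $ \<mu> $ \<nu>"
    using region_pos[OF x]
    unfolding forall_4 christoffel_def sum_4 ginv_star[OF x] pd_star_metric[OF x] star_christoffel_def Let_def
      w_def[symmetric]
    by (simp add: diag4_nth) (simp add: field_simps power2_eq_square)
  then show ?thesis by blast
qed

text \<open>Disposes of the many terms of the Riemann tensor whose table entry is identically
  zero.\<close>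

lemma pd_christoffel_star_0:
  assumes x: "x \<in> M" and "\<And>x. star_christoffel x $ \<rho> $ \<mu> $ \<nu> = 0"
  shows "pd M l (christoffel M g \<rho> \<mu> \<nu>) x = 0"
proof -
  have "pd M l (christoffel M g \<rho> \<mu> \<nu>) x = pd M l (\<lambda>x. 0) x"
    by (rule pd_cong[OF x]) (simp add: christoffel_star assms(2))
  also have "\<dots> = 0"
    by (rule pd_const[OF slice_nontrivial[OF x]]) (rule refl)
  finally show ?thesis .
qed

text \<open>As the inverse metric is diagonal, only the diagonal Ricci components will enter. Terms
  such as the 2-derivative of \<open>christoffel M g 2 2 2\<close> cancel in them; these are the
  nonzero derivatives that remain.\<close>

lemma pd_christoffel_star:
  assumes x: "x \<in> M"
  defines "A \<equiv> a (x $ 1)" and "A' \<equiv> a1 (x $ 1)" and "A'' \<equiv> a2 (x $ 1)" and "r \<equiv> x $ 2"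
    and "w \<equiv> 1 - k * (x $ 2)\<^sup>2" and "s \<equiv> sin (x $ 3)" and "c \<equiv> cos (x $ 3)"
  shows "i \<noteq> 1 \<Longrightarrow> pd M 1 (christoffel M g i 1 i) x = (A'' * A - A'\<^sup>2) / A\<^sup>2"
    and "pd M 1 (christoffel M g 1 2 2) x = (A'\<^sup>2 + A * A'') / w"
    and "pd M 1 (christoffel M g 1 3 3) x = (A'\<^sup>2 + A * A'') * r\<^sup>2"
    and "pd M 1 (christoffel M g 1 4 4) x = (A'\<^sup>2 + A * A'') * r\<^sup>2 * s\<^sup>2"
    and "pd M 2 (christoffel M g 3 2 3) x = - 1 / r\<^sup>2"
    and "pd M 2 (christoffel M g 4 2 4) x = - 1 / r\<^sup>2"
    and "pd M 2 (christoffel M g 2 3 3) x = 3 * k * r\<^sup>2 - 1"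
    and "pd M 2 (christoffel M g 2 4 4) x = (3 * k * r\<^sup>2 - 1) * s\<^sup>2"
    and "pd M 3 (christoffel M g 4 3 4) x = - 1 / s\<^sup>2"
    and "pd M 3 (christoffel M g 3 4 4) x = s\<^sup>2 - c\<^sup>2"
proof -
  note defs = A_def A'_def A''_def r_def w_def s_def c_def
  note pos = region_pos[OF x]
  note a' = a_deriv[OF pos(5)] a1_deriv[OF pos(5)]
  \<comment> \<open>The numerator that the quotient rule leaves for the cotangent.\<close>
  have sc: "- (sin (x $ 3) * sin (x $ 3)) - cos (x $ 3) * cos (x $ 3) = - 1"
    using sin_cos_squared_add[of "x $ 3"] by (simp add: power2_eq_square)
  have chr: "pd M l (christoffel M g \<rho> \<mu> \<nu>) x = pd M l (\<lambda>x. star_christoffel x $ \<rho> $ \<mu> $ \<nu>) x"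
    for l \<rho> \<mu> \<nu>
    by (rule pd_cong[OF x]) (simp add: christoffel_star)
  note [simp] = star_christoffel_def Let_def axis_def diag4_nth
  show "pd M 1 (christoffel M g i 1 i) x = (A'' * A - A'\<^sup>2) / A\<^sup>2" if "i \<noteq> 1"
    unfolding chr
    by (rule pd_1[OF x x, where h = "\<lambda>u. a1 u / a u"])
      (use pos that exhaust_4[of i] in \<open>auto intro!: derivative_eq_intros a' simp: defs power2_eq_square\<close>)
  show "pd M 1 (christoffel M g 1 2 2) x = (A'\<^sup>2 + A * A'') / w"
    unfolding chr
    by (rule pd_1[OF x x, where h = "\<lambda>u. a u * a1 u / w"])
      (use pos in \<open>auto intro!: derivative_eq_intros a' simp: defs power2_eq_square\<close>)
  show "pd M 1 (christoffel M g 1 3 3) x = (A'\<^sup>2 + A * A'') * r\<^sup>2"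
    unfolding chr
    by (rule pd_1[OF x x, where h = "\<lambda>u. a u * a1 u * r\<^sup>2"])
      (use pos in \<open>auto intro!: derivative_eq_intros a' simp: defs power2_eq_square\<close>)
  show "pd M 1 (christoffel M g 1 4 4) x = (A'\<^sup>2 + A * A'') * r\<^sup>2 * s\<^sup>2"
    unfolding chr
    by (rule pd_1[OF x x, where h = "\<lambda>u. a u * a1 u * r\<^sup>2 * s\<^sup>2"])
      (use pos in \<open>auto intro!: derivative_eq_intros a' simp: defs power2_eq_square\<close>)
  show "pd M 2 (christoffel M g 3 2 3) x = - 1 / r\<^sup>2" "pd M 2 (christoffel M g 4 2 4) x = - 1 / r\<^sup>2"
    unfolding chr
    by (rule pd_2[OF x x, where h = "\<lambda>u. 1 / u"];
        use pos in \<open>auto intro!: derivative_eq_intros simp: defs power2_eq_square\<close>)+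
  show "pd M 2 (christoffel M g 2 3 3) x = 3 * k * r\<^sup>2 - 1"
    unfolding chr
    by (rule pd_2[OF x x, where h = "\<lambda>u. - (u * (1 - k * u\<^sup>2))"])
      (use pos in \<open>auto intro!: derivative_eq_intros simp: defs power2_eq_square algebra_simps\<close>)
  show "pd M 2 (christoffel M g 2 4 4) x = (3 * k * r\<^sup>2 - 1) * s\<^sup>2"
    unfolding chr
    by (rule pd_2[OF x x, where h = "\<lambda>u. - (u * (1 - k * u\<^sup>2) * s\<^sup>2)"])
      (use pos in \<open>auto intro!: derivative_eq_intros simp: defs power2_eq_square algebra_simps\<close>)
  show "pd M 3 (christoffel M g 4 3 4) x = - 1 / s\<^sup>2"
    unfolding chr
    by (rule pd_3[OF x x, where h = "\<lambda>u. cos u / sin u"])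
      (use pos in \<open>auto intro!: derivative_eq_intros simp: defs power2_eq_square sc\<close>)
  show "pd M 3 (christoffel M g 3 4 4) x = s\<^sup>2 - c\<^sup>2"
    unfolding chr
    by (rule pd_3[OF x x, where h = "\<lambda>u. - (sin u * cos u)"])
      (use pos in \<open>auto intro!: derivative_eq_intros simp: defs power2_eq_square\<close>)
qed

text \<open>The Friedmann expressions for the Ricci tensor, with the overall sign reversed by the
  curvature convention in use.\<close>

lemma ricci_star:
  assumes x: "x \<in> M"
  defines "Q \<equiv> a (x $ 1) * a2 (x $ 1) + 2 * (a1 (x $ 1))\<^sup>2 + 2 * k" and "r \<equiv> x $ 2"
  shows "ricci M g 1 1 x = 3 * a2 (x $ 1) / a (x $ 1)"
    and "ricci M g 2 2 x = - Q / (1 - k * r\<^sup>2)"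
    and "ricci M g 3 3 x = - Q * r\<^sup>2"
    and "ricci M g 4 4 x = - Q * r\<^sup>2 * (sin (x $ 3))\<^sup>2"
proof -
  define A where "A = a (x $ 1)"
  define A' where "A' = a1 (x $ 1)"
  define A'' where "A'' = a2 (x $ 1)"
  define w where "w = 1 - k * (x $ 2)\<^sup>2"
  define s where "s = sin (x $ 3)"
  define c where "c = cos (x $ 3)"
  have pos: "A > 0" "r > 0" "w > 0" "s > 0"
    using region_pos[OF x] by (simp_all add: A_def r_def w_def s_def)
  \<comment> \<open>These two identities relate the cosine and \<open>k\<close> to the atoms
    \<open>s\<close> and \<open>w\<close>.\<close>
  have c2: "c\<^sup>2 = 1 - s\<^sup>2" and kr: "k * r\<^sup>2 = 1 - w"
    by (simp_all add: c_def s_def cos_squared_eq w_def r_def)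
  note fold = A_def[symmetric] A'_def[symmetric] A''_def[symmetric] r_def[symmetric] w_def[unfolded r_def[symmetric], symmetric]
    s_def[symmetric] c_def[symmetric]
  note pd = pd_christoffel_star[OF x, unfolded fold] pd_christoffel_star_0[OF x]
  have chr: "star_christoffel x = vector
      [diag4 0 (A * A' / w) (A * A' * r\<^sup>2) (A * A' * r\<^sup>2 * s\<^sup>2),
       vector [vector [0, A'/A, 0, 0], vector [A'/A, k * r / w, 0, 0], vector [0, 0, - (r * w), 0], vector [0, 0, 0, - (r * w * s\<^sup>2)]],
       vector [vector [0, 0, A'/A, 0], vector [0, 0, 1 / r, 0], vector [A'/A, 1 / r, 0, 0], vector [0, 0, 0, - (s * c)]],
       vector [vector [0, 0, 0, A'/A], vector [0, 0, 0, 1 / r], vector [0, 0, 0, c / s], vector [A'/A, 1 / r, c / s, 0]]]"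
    unfolding star_christoffel_def Let_def fold ..
  have r1: "ricci M g 1 1 x = 3 * A'' / A"
    unfolding ricci_def riemann_def sum_4 christoffel_star[OF x] chr
    using pos
    by (simp add: diag4_nth pd star_christoffel_def Let_def) (simp add: field_simps power2_eq_square)
  have r2: "ricci M g 2 2 x = - Q / w"
    unfolding ricci_def riemann_def sum_4 christoffel_star[OF x] chr Q_def fold
    using pos kr
    by (simp add: diag4_nth pd star_christoffel_def Let_def) (simp add: field_simps power2_eq_square)
  have r3: "ricci M g 3 3 x = - Q * r\<^sup>2"
    unfolding ricci_def riemann_def sum_4 christoffel_star[OF x] chr Q_def fold
    using pos kr c2
    by (simp add: diag4_nth pd star_christoffel_def Let_def) (simp add: field_simps power2_eq_square)
  have r4: "ricci M g 4 4 x = - Q * r\<^sup>2 * s\<^sup>2"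
    unfolding ricci_def riemann_def sum_4 christoffel_star[OF x] chr Q_def fold
    using pos kr c2
    by (simp add: diag4_nth pd star_christoffel_def Let_def) (simp add: field_simps power2_eq_square)
  show "ricci M g 1 1 x = 3 * a2 (x $ 1) / a (x $ 1)" "ricci M g 2 2 x = - Q / (1 - k * r\<^sup>2)"
    "ricci M g 3 3 x = - Q * r\<^sup>2" "ricci M g 4 4 x = - Q * r\<^sup>2 * (sin (x $ 3))\<^sup>2"
    unfolding fold by (fact r1 r2 r3 r4)+
qed

text \<open>Only time enters the formula. This homogeneity carries the value on the surface to every
  point of the star.\<close>

lemma ricci_scalar_star:
  assumes x: "x \<in> M"
  shows "ricci_scalar M g x = 6 * (((a1 (x $ 1))\<^sup>2 + k) / (a (x $ 1))\<^sup>2 + a2 (x $ 1) / a (x $ 1))"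
  using region_pos[OF x] unfolding ricci_scalar_def sum_4 ginv_star[OF x]
  by (simp add: diag4_nth ricci_star[OF x]) (simp add: field_simps power2_eq_square)

text \<open>A constant Ricci scalar makes f_R constant on the region, so its Hessian and box vanish.
  Contraction with the inverse metric then turns f/2 into 4 f/2 and the dust tensor into \<rho>,
  since \<open>u\<close> has unit length.\<close>

lemma field_equations_trace:
  assumes eq: "fR_field_equations f I \<kappa> M g (dust_stress g \<rho>)"
    and R: "\<And>x. x \<in> M \<Longrightarrow> ricci_scalar M g x = R0" and "\<tau> \<in> {0..<\<tau>c}"
  shows "der I f R0 * R0 - 2 * f R0 = - \<kappa> * \<rho> \<tau>"
proof -
  define x :: "real^4" where "x = vector [\<tau>, \<chi>s, pi/2, 0]"
  have x: "x \<in> M" using assms(3) \<chi>s_pos by (simp add: x_def star_region_def)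
  let ?F = "\<lambda>x. der I f (ricci_scalar M g x)"
  have pd_eq_0: "pd M i F z = 0" if "z \<in> M" "\<And>y. y \<in> M \<Longrightarrow> F y = d" for i F z d
  proof -
    have "pd M i F z = pd M i (\<lambda>y. d) z" using that by (rule pd_cong)
    also have "\<dots> = 0" by (rule pd_const[OF slice_nontrivial[OF that(1)]]) (rule refl)
    finally show ?thesis .
  qed
  \<comment> \<open>Vanishing at every point of the region, not just at \<open>x\<close>, is what
    allows the second differentiation in \<open>hess\<close>.\<close>
  have dF: "pd M i ?F z = 0" if "z \<in> M" for i z
    by (rule pd_eq_0[OF that, of _ "der I f R0"]) (simp add: R)
  have hess: "hess M g ?F \<mu> \<nu> x = 0" for \<mu> \<nu>
    unfolding hess_def by (simp add: dF[OF x] pd_eq_0[OF x dF])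
  have "der I f R0 * ricci M g \<mu> \<nu> x - 1/2 * f R0 * (g x $ \<mu> $ \<nu>) = - \<kappa> * dust_stress g \<rho> \<mu> \<nu> x" for \<mu> \<nu>
  proof -
    have "der I f (ricci_scalar M g x) * ricci M g \<mu> \<nu> x - 1/2 * f (ricci_scalar M g x) * (g x $ \<mu> $ \<nu>)
        + (hess M g ?F \<mu> \<nu> x - (g x $ \<mu> $ \<nu>) * box M g ?F x) = - \<kappa> * dust_stress g \<rho> \<mu> \<nu> x"
      using eq x unfolding fR_field_equations_def by blast
    then show ?thesis unfolding box_def hess R[OF x] by simp
  qed
  then have Ric: "der I f R0 * ricci M g \<mu> \<nu> x = 1/2 * f R0 * (g x $ \<mu> $ \<nu>) - \<kappa> * dust_stress g \<rho> \<mu> \<nu> x" for \<mu> \<nu>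
    by (simp add: algebra_simps)
  have "der I f R0 * ricci_scalar M g x = (\<Sum>\<mu>\<in>UNIV. \<Sum>\<nu>\<in>UNIV. ginv g \<mu> \<nu> x * (der I f R0 * ricci M g \<mu> \<nu> x))"
    unfolding ricci_scalar_def sum_distrib_left by (simp only: mult.left_commute)
  also have "\<dots> = 2 * f R0 - \<kappa> * \<rho> \<tau>"
    unfolding Ric sum_4 ginv_star[OF x] using region_pos[OF x]
    by (simp add: diag4_nth star_metric_def dust_stress_def sum_4 axis_def) (simp add: x_def field_simps)
  finally show ?thesis by (simp add: R[OF x])
qed

end

section \<open>A constant Ricci scalar excludes collapse\<close>

lemma smooth_on_has_real_derivatives:
  assumes "smooth_on S F"
  obtains F' F'' where "\<And>x. x \<in> S \<Longrightarrow> (F has_real_derivative F' x) (at x within S)"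
    and "\<And>x. x \<in> S \<Longrightarrow> (F' has_real_derivative F'' x) (at x within S)"
proof -
  have D: "(G has_real_derivative frechet_derivative G (at x within S) 1) (at x within S)"
    if "G differentiable_on S" "x \<in> S" for G :: "real \<Rightarrow> real" and x
  proof -
    have G: "(G has_derivative frechet_derivative G (at x within S)) (at x within S)"
      using that by (simp add: differentiable_on_def frechet_derivative_works)
    have "(*) (frechet_derivative G (at x within S) 1) = frechet_derivative G (at x within S)"
    proof
      show "frechet_derivative G (at x within S) 1 * h = frechet_derivative G (at x within S) h" for h
        using linear_scale[OF has_derivative_linear[OF G], of h 1] by (simp add: mult.commute)
    qed
    with G show ?thesis by (simp only: has_field_derivative_def)
  qed
  let ?F' = "\<lambda>x. frechet_derivative F (at x within S) 1"
  have "Ck_on (Suc (Suc 0)) S F" using assms by (simp only: smooth_on_def)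
  then have "F differentiable_on S" "?F' differentiable_on S" by simp_all
  then show thesis using that[of ?F' "\<lambda>x. frechet_derivative ?F' (at x within S) 1"] D by simp
qed

theorem mainTheorem3:
  fixes f :: "real \<Rightarrow> real" and I :: "real set" and \<kappa> :: real
  assumes "0 < \<kappa>"
    and "is_interval I" and "interior I \<noteq> {}"
    and "smooth_on I f"
    and "\<forall>R\<in>I. der I (der I f) R \<noteq> 0"
  shows "\<not> (\<exists>(\<D> :: (real \<times> real) set) (A :: real \<Rightarrow> real \<Rightarrow> real)
            (k :: real) (\<rho>0 :: real) (\<chi>s :: real) (\<tau>c :: real) (a :: real \<Rightarrow> real)
            (ts :: real \<Rightarrow> real) (rs :: real \<Rightarrow> real).
            vacuum_exterior f I \<kappa> \<D> A (\<lambda>t r. 1 / A t r) \<and>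
            collapsing_dust_star f I \<kappa> k \<rho>0 \<chi>s \<tau>c a \<and>
            smoothly_matched k \<chi>s \<tau>c a \<D> A (\<lambda>t r. 1 / A t r) ts rs \<and>
            junction_everywhere k \<chi>s \<D> A (\<lambda>t r. 1 / A t r))"
proof (rule notI, elim exE conjE)
  fix \<D> A k \<rho>0 \<chi>s \<tau>c a ts rs
  assume ext: "vacuum_exterior f I \<kappa> \<D> A (\<lambda>t r. 1 / A t r)"
    and star: "collapsing_dust_star f I \<kappa> k \<rho>0 \<chi>s \<tau>c a"
    and matched: "smoothly_matched k \<chi>s \<tau>c a \<D> A (\<lambda>t r. 1 / A t r) ts rs"
    and junction: "junction_everywhere k \<chi>s \<D> A (\<lambda>t r. 1 / A t r)"
  let ?M = "star_region \<chi>s \<tau>c" and ?g = "star_metric k a"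
  have pos: "0 < \<rho>0" "0 < \<chi>s" "0 < 1 - k * \<chi>s\<^sup>2" "0 < \<tau>c" "\<And>\<tau>. \<tau> \<in> {0..<\<tau>c} \<Longrightarrow> 0 < a \<tau>"
    and a0: "a 0 = 1" and collapse: "\<And>\<tau>. \<tau> \<in> {0<..<\<tau>c} \<Longrightarrow> der {0..<\<tau>c} a \<tau> < 0"
    and smooth: "smooth_on {0..<\<tau>c} a"
    and eq: "fR_field_equations f I \<kappa> ?M ?g (dust_stress ?g (\<lambda>\<tau>. \<rho>0 / (a \<tau>) ^ 3))"
    using star unfolding collapsing_dust_star_def by auto
  obtain a1 a2 where "\<And>\<tau>. \<tau> \<in> {0..<\<tau>c} \<Longrightarrow> (a has_real_derivative a1 \<tau>) (at \<tau> within {0..<\<tau>c})"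
    "\<And>\<tau>. \<tau> \<in> {0..<\<tau>c} \<Longrightarrow> (a1 has_real_derivative a2 \<tau>) (at \<tau> within {0..<\<tau>c})"
    using smooth_on_has_real_derivatives[OF smooth] by blast
  then interpret dust_star k \<chi>s \<tau>c a a1 a2
    using pos by unfold_locales auto
  obtain R0 where R0: "\<And>t r. (t, r) \<in> \<D> \<Longrightarrow>
      ricci_scalar (ext_region \<D>) (ext_metric A (\<lambda>t r. 1 / A t r)) (vector [t, r, pi/2, 0]) = R0"
    using exterior_ricci_scalar_const[OF ext junction pos(3)] by blast
  have R: "ricci_scalar ?M ?g x = R0" if x: "x \<in> ?M" for x
  proof -
    \<comment> \<open>The junction condition is read off at the same time on the equator of the
      surface, the slice on which the exterior value \<open>R0\<close> is known; homogeneity then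
      leads from \<open>?z\<close> to \<open>x\<close>.\<close>
    let ?y = "vector [x $ 1, pi/2, 0] :: real^3" and ?z = "vector [x $ 1, \<chi>s, pi/2, 0] :: real^4"
    have \<tau>: "x $ 1 \<in> {0..<\<tau>c}" using x by (simp add: star_region_def)
    then have "?y \<in> surface \<tau>c" by (simp add: surface_def)
    then have "ricci_scalar (ext_region \<D>) (ext_metric A (\<lambda>t r. 1 / A t r)) (ext_embedding ts rs ?y)
        = ricci_scalar ?M ?g (star_embedding \<chi>s ?y)"
      using matched unfolding smoothly_matched_def junction_conditions_def by force
    moreover have "(ts (x $ 1), rs (x $ 1)) \<in> \<D>"
      using matched \<tau> unfolding smoothly_matched_def by blast
    ultimately have "ricci_scalar ?M ?g ?z = R0"
      using R0 by (simp add: ext_embedding_def star_embedding_def)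
    moreover have "?z \<in> ?M" using \<tau> \<chi>s_pos by (simp add: star_region_def)
    ultimately show ?thesis using ricci_scalar_star[OF x] ricci_scalar_star[of ?z] by simp
  qed
  have a_const: "a \<tau> = 1" if \<tau>: "\<tau> \<in> {0..<\<tau>c}" for \<tau>
  proof -
    have trace: "der I f R0 * R0 - 2 * f R0 = - \<kappa> * (\<rho>0 / a \<sigma> ^ 3)" if "\<sigma> \<in> {0..<\<tau>c}" for \<sigma>
      by (rule field_equations_trace[OF eq _ that]) (rule R)
    have "0 \<in> {0..<\<tau>c}" using \<tau>c_pos by simp
    \<comment> \<open>The left side of the trace is the same at all times, so any time may be
      compared with time 0, where \<open>a\<close> is 1.\<close>
    then have "- \<kappa> * (\<rho>0 / a \<tau> ^ 3) = - \<kappa> * (\<rho>0 / a 0 ^ 3)"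
      by (rule trans[OF trace[OF \<tau>, symmetric] trace])
    then have "a \<tau> ^ 3 = 1 ^ 3"
      using assms(1) pos(1) pos(5)[OF \<tau>] a0 by (simp add: field_simps)
    then show ?thesis
      by (rule power_eq_imp_eq_base) (use pos(5)[OF \<tau>] in auto)
  qed
  \<comment> \<open>A time after the start is required: at 0 itself the star begins at rest, and a
    vanishing derivative is no contradiction.\<close>
  have \<tau>: "\<tau>c / 2 \<in> {0<..<\<tau>c}" using \<tau>c_pos by simp
  have "at (\<tau>c / 2) within {0..<\<tau>c} = at (\<tau>c / 2)"
    using \<tau> by (intro at_within_interior interiorI[of "{0<..<\<tau>c}"]) auto
  moreover have "(a has_vector_derivative 0) (at (\<tau>c / 2) within {0..<\<tau>c})"
    using \<tau> a_const by (intro has_vector_derivative_transform[OF _ _ has_vector_derivative_const]) auto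
  ultimately have "der {0..<\<tau>c} a (\<tau>c / 2) = 0"
    by (simp add: der_def vector_derivative_at)
  with collapse[OF \<tau>] show False by simp
qed

end
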